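(* Let $(P,r)$ be a finite graded poset whose order complex $\varDelta(P)$ is a triangulation of an $n$-dimensional homology manifold $X$. Then for $0\le k\le n$, $$H_i(\varDelta^{(k)}(P))\cong H_i(X)\qquad (i\le k-1),$$ and for $0\le k\le n-1$ the group $H_k(\varDelta^{(k)}(P);\mathbb{Z})$ is a nontrivial free abelian group.
   Context: All homology is with integer coefficients. A topological space $X$ is a homology $n$-manifold (without boundary) if for every $x\in X$ the local homology $H_i(X,X\setminus\{x\})$ is $0$ for $i\ne n$ and is isomorphic to $\mathbb{Z}$ for $i=n$. A finite poset $P$ is graded of rank $m\ge 0$ if every maximal chain of $P$ has length $m$ (i.e. $m+1$ elements); its rank function $r$ satisfies $r(x)=0$ for $x$ minimal and $r(y)=r(x)+1$ if $y$ covers $x$. The order complex $\varDelta(P)$ is the abstract simplicial complex whose simplices are the chains of $P$, and $\varDelta^{(k)}(P)=\{(x_0<\cdots<x_l)\mid r(x_l)-r(x_0)\le k\}\subseteq\varDelta(P)$. *)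

theory Defs
  imports "HOL-Homology.Homology"
begin

definition homology_manifold :: "nat \<Rightarrow> 'a topology \<Rightarrow> bool" where
  "homology_manifold n X \<longleftrightarrow>
     (\<forall>x\<in>topspace X. \<forall>i::int.
        (i \<noteq> int n \<longrightarrow> trivial_group (relative_homology_group i X (topspace X - {x}))) \<and>
        (i = int n \<longrightarrow> relative_homology_group i X (topspace X - {x}) \<cong> integer_group))"

text \<open>
  A poset is a carrier \<open>P\<close> with a reflexive order relation \<open>leq\<close> satisfying
  \<open>partial_order_on P leq\<close>; this gives \<open>leq \<subseteq> P \<times> P\<close>, so all members of
  \<open>Chains leq\<close> are subsets of \<open>P\<close>. Since the empty set is a chain, the empty poset is not
  graded of any rank \<open>m \<ge> 0\<close>.
\<close>

definition maximal_chain :: "'a rel \<Rightarrow> 'a set \<Rightarrow> bool" where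
  "maximal_chain leq C \<longleftrightarrow> C \<in> Chains leq \<and> (\<forall>D\<in>Chains leq. C \<subseteq> D \<longrightarrow> D = C)"

definition finite_graded_poset :: "'a set \<Rightarrow> 'a rel \<Rightarrow> nat \<Rightarrow> bool" where
  "finite_graded_poset P leq m \<longleftrightarrow>
     finite P \<and> partial_order_on P leq \<and> (\<forall>C. maximal_chain leq C \<longrightarrow> card C = m + 1)"

definition minimal_element :: "'a set \<Rightarrow> 'a rel \<Rightarrow> 'a \<Rightarrow> bool" where
  "minimal_element P leq x \<longleftrightarrow> x \<in> P \<and> (\<forall>y\<in>P. (y, x) \<in> leq \<longrightarrow> y = x)"

definition covers :: "'a set \<Rightarrow> 'a rel \<Rightarrow> 'a \<Rightarrow> 'a \<Rightarrow> bool" where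
  "covers P leq y x \<longleftrightarrow> x \<in> P \<and> y \<in> P \<and> x \<noteq> y \<and> (x, y) \<in> leq \<and>
     (\<forall>z\<in>P. (x, z) \<in> leq \<and> (z, y) \<in> leq \<longrightarrow> z = x \<or> z = y)"

definition is_rank_function :: "'a set \<Rightarrow> 'a rel \<Rightarrow> ('a \<Rightarrow> nat) \<Rightarrow> bool" where
  "is_rank_function P leq r \<longleftrightarrow>
     (\<forall>x. minimal_element P leq x \<longrightarrow> r x = 0) \<and>
     (\<forall>x y. covers P leq y x \<longrightarrow> r y = r x + 1)"

text \<open>
  An abstract simplicial complex is given by the set of its simplices, which are nonempty finite
  sets of vertices.
\<close>

definition order_complex :: "'a rel \<Rightarrow> 'a set set" where
  "order_complex leq = {C \<in> Chains leq. finite C \<and> C \<noteq> {}}"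

text \<open>
  In the next definition \<open>x\<close> and \<open>y\<close> are the bottom and top elements of the chain \<open>C\<close>; the
  inequality is \<open>r y - r x \<le> k\<close>, written without truncated subtraction.
\<close>

definition rank_truncated_complex :: "'a rel \<Rightarrow> ('a \<Rightarrow> nat) \<Rightarrow> nat \<Rightarrow> 'a set set" where
  "rank_truncated_complex leq r k =
     {C \<in> order_complex leq. \<exists>x\<in>C. \<exists>y\<in>C.
        (\<forall>z\<in>C. (x, z) \<in> leq \<and> (z, y) \<in> leq) \<and> r y \<le> r x + k}"

text \<open>
  Geometric realization by barycentric coordinates. The topology is that of pointwise convergence
  (as for \<open>standard_simplex\<close>), which is the usual topology of the realization when the
  complex is finite.
\<close>

definition geometric_realization :: "'a set set \<Rightarrow> ('a \<Rightarrow> real) topology" where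
  "geometric_realization K =
     subtopology (powertop_real UNIV)
       {t. (\<forall>v. 0 \<le> t v) \<and> {v. t v \<noteq> 0} \<in> K \<and> (\<Sum>v\<in>{v. t v \<noteq> 0}. t v) = 1}"

definition triangulates :: "'a set set \<Rightarrow> 'b topology \<Rightarrow> bool" where
  "triangulates K X \<longleftrightarrow> geometric_realization K homeomorphic_space X"

definition complex_homology :: "int \<Rightarrow> 'a set set \<Rightarrow> ('a \<Rightarrow> real) chain set monoid" where
  "complex_homology i K = homology_group i (geometric_realization K)"

text \<open>
  No generality is lost by indexing the basis by a subset of the carrier, since a basis of a free
  abelian group is such a subset.
\<close>

definition free_abelian :: "('a, 'b) monoid_scheme \<Rightarrow> bool" where
  "free_abelian G \<longleftrightarrow> comm_group G \<and> (\<exists>B\<subseteq>carrier G. G \<cong> free_Abelian_group B)"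

end

theory Submission
  imports Defs
begin

text \<open>
  Everything is derived from the Eilenberg--Steenrod axioms for realizations of finite complexes.
  For a simplex \<open>s\<close> of \<open>K\<close>, the local homology of \<open>K\<close> at the barycenter of \<open>s\<close> is the homology
  of \<open>K\<close> relative to the simplices that do not contain \<open>s\<close>; by excision it depends only on the
  star of \<open>s\<close>, and coning \<open>K\<close> and \<open>s\<close> with a new vertex shifts it by one degree. Applied to the chain
  made of \<open>x\<close>, \<open>y\<close> and the parts below \<open>x\<close> and above \<open>y\<close> of a maximal chain, this shows that the complex
  of the interval from \<open>x\<close> to \<open>y\<close>, relative to the chains missing \<open>x\<close> or \<open>y\<close>, has the homology of a
  ball of dimension \<open>r y - r x\<close> relative to its boundary. The step from the \<open>k\<close>-th to the
  \<open>(k + 1)\<close>-st truncation attaches such pairs for all intervals of rank \<open>k + 1\<close>, so it behaves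
  like attaching \<open>(k + 1)\<close>-cells and does not change the homology below degree \<open>k\<close>. The homology in degree
  \<open>k\<close> of a \<open>k\<close>-dimensional complex is free, and the boundary of one interval of
  rank \<open>k + 1\<close> carries a nonzero class.
\<close>

section \<open>Exact sequences\<close>

lemma exact_seq_middle_trivial:
  assumes "exact_seq ([C, B, A], [g, f])" "trivial_group A" "trivial_group C"
  shows "trivial_group B"
proof -
  have f: "group_hom A B f" and g: "group_hom B C g" and k: "kernel B C g = f ` carrier A"
    using assms(1) by (auto simp: group_hom_def group_hom_axioms_def)
  have "group B" using f by (simp add: group_hom_def)
  have "f ` carrier A = {\<one>\<^bsub>B\<^esub>}"
    using f assms(2) by (simp add: group_hom.image_from_trivial_group)
  moreover have "kernel B C g = carrier B"
    using g assms(3) by (simp add: group_hom.kernel_to_trivial_group)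
  ultimately show ?thesis using k \<open>group B\<close> by (simp add: trivial_group_def)
qed

lemma exact_seq_trivial_imp_inj:
  assumes "exact_seq ([C, B, A], [g, f])" "trivial_group A"
  shows "inj_on g (carrier B)"
proof -
  have f: "group_hom A B f" and g: "group_hom B C g" and k: "kernel B C g = f ` carrier A"
    using assms(1) by (auto simp: group_hom_def group_hom_axioms_def)
  have "kernel B C g = {\<one>\<^bsub>B\<^esub>}"
    using f assms(2) k by (simp add: group_hom.image_from_trivial_group)
  then show ?thesis by (rule group_hom.trivial_ker_imp_inj[OF g])
qed

text \<open>For \<open>T \<subseteq> S\<close> the sequence of the triple runs through the pairs
  \<open>(S, T)\<close>, \<open>(X, T)\<close> and \<open>(X, S)\<close>. This lemma and the next
  two each sandwich one of these pairs between the other two.\<close>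

lemma relative_homology_trans_trivial:
  assumes "T \<subseteq> S" "trivial_group (relative_homology_group p (subtopology X S) T)"
    "trivial_group (relative_homology_group p X S)"
  shows "trivial_group (relative_homology_group p X T)"
  using exact_seq_middle_trivial[OF homology_exactness_triple_3] assms by blast

lemma relative_homology_subspace_trivial:
  assumes "T \<subseteq> S" "trivial_group (relative_homology_group (p + 1) X S)"
    "trivial_group (relative_homology_group p X T)"
  shows "trivial_group (relative_homology_group p (subtopology X S) T)"
  using exact_seq_middle_trivial[OF homology_exactness_triple_2[OF assms(1), of "p+1" X]] assms
  by simp

lemma relative_homology_quotient_trivial:
  assumes "T \<subseteq> S" "trivial_group (relative_homology_group p X T)"
    "trivial_group (relative_homology_group (p - 1) (subtopology X S) T)"
  shows "trivial_group (relative_homology_group p X S)"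
  using exact_seq_middle_trivial[OF homology_exactness_triple_1] assms by blast

text \<open>Four consecutive terms of the triple's sequence with trivial ends leave an isomorphism
  in the middle. The next two lemmas place the trivial ends at the other two pairs.\<close>

lemma relative_homology_iso_subspace:
  assumes "T \<subseteq> S" "trivial_group (relative_homology_group (p + 1) X S)"
    "trivial_group (relative_homology_group p X S)"
  shows "relative_homology_group p (subtopology X S) T \<cong> relative_homology_group p X T"
proof -
  have "exact_seq ([relative_homology_group p X S, relative_homology_group p X T,
        relative_homology_group p (subtopology X S) T, relative_homology_group (p + 1) X S],
      [hom_induced p X T X S id, hom_induced p (subtopology X S) T X T id, hom_relboundary (p+1) X S T])"
    using homology_exactness_triple_2[OF assms(1), of "p+1" X] homology_exactness_triple_3[OF assms(1), of p X]
    by simp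
  from very_short_exact_sequence[OF this] assms show ?thesis
    by (meson is_isoI)
qed

lemma relative_homology_iso_quotient:
  assumes "T \<subseteq> S" "trivial_group (relative_homology_group p (subtopology X S) T)"
    "trivial_group (relative_homology_group (p - 1) (subtopology X S) T)"
  shows "relative_homology_group p X T \<cong> relative_homology_group p X S"
proof -
  have "exact_seq ([relative_homology_group (p-1) (subtopology X S) T, relative_homology_group p X S,
      relative_homology_group p X T, relative_homology_group p (subtopology X S) T],
      [hom_relboundary p X S T, hom_induced p X T X S id, hom_induced p (subtopology X S) T X T id])"
    using homology_exactness_triple_1[OF assms(1), of p X] homology_exactness_triple_3[OF assms(1), of p X]
    by simp
  from very_short_exact_sequence[OF this] assms show ?thesis
    by (meson is_isoI)
qed

lemma relative_homology_iso_boundary: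
  assumes "T \<subseteq> S" "trivial_group (relative_homology_group p X T)"
    "trivial_group (relative_homology_group (p - 1) X T)"
  shows "relative_homology_group p X S \<cong> relative_homology_group (p - 1) (subtopology X S) T"
proof -
  have "exact_seq ([relative_homology_group (p-1) X T, relative_homology_group (p-1) (subtopology X S) T,
      relative_homology_group p X S, relative_homology_group p X T],
      [hom_induced (p-1) (subtopology X S) T X T id, hom_relboundary p X S T, hom_induced p X T X S id])"
    using homology_exactness_triple_1[OF assms(1), of p X] homology_exactness_triple_2[OF assms(1), of p X]
    by simp
  from very_short_exact_sequence[OF this] assms show ?thesis
    by (meson is_isoI)
qed

section \<open>Free abelian groups of finite rank\<close>

text \<open>A formal sum over \<open>{..<Suc k}\<close> splits uniquely into its part over
  \<open>{..<k}\<close> and its coefficient at \<open>k\<close>. This raises the rank by one in the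
  extension argument below.\<close>

lemma free_Abelian_group_Suc_iso:
  "(\<lambda>(c, n). c + frag_cmul n (frag_of k)) \<in> iso (free_Abelian_group {..<k} \<times>\<times> integer_group)
     (free_Abelian_group {..<Suc k})" (is "?h \<in> _")
proof (rule isoI)
  show "?h \<in> hom (free_Abelian_group {..<k} \<times>\<times> integer_group) (free_Abelian_group {..<Suc k})"
  proof (rule homI)
    fix x assume "x \<in> carrier (free_Abelian_group {..<k} \<times>\<times> integer_group)"
    then obtain c n where x: "x = (c, n)" "Poly_Mapping.keys c \<subseteq> {..<k}" by auto
    have "Poly_Mapping.keys (c + frag_cmul n (frag_of k)) \<subseteq> Poly_Mapping.keys c \<union> {k}"
      using keys_add[of c "frag_cmul n (frag_of k)"] keys_cmul[of n "frag_of k"] by auto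
    then show "?h x \<in> carrier (free_Abelian_group {..<Suc k})"
      using x by auto
  qed (auto simp: integer_group_def frag_cmul_distrib)
  show "bij_betw ?h (carrier (free_Abelian_group {..<k} \<times>\<times> integer_group)) (carrier (free_Abelian_group {..<Suc k}))"
  proof (rule bij_betwI[where g = "\<lambda>c. (c - frag_cmul (Poly_Mapping.lookup c k) (frag_of k), Poly_Mapping.lookup c k)"])
    show "?h \<in> carrier (free_Abelian_group {..<k} \<times>\<times> integer_group) \<rightarrow> carrier (free_Abelian_group {..<Suc k})"
    proof
      fix x assume "x \<in> carrier (free_Abelian_group {..<k} \<times>\<times> integer_group)"
      then obtain c n where x: "x = (c, n)" "Poly_Mapping.keys c \<subseteq> {..<k}" by auto
      have "Poly_Mapping.keys (c + frag_cmul n (frag_of k)) \<subseteq> Poly_Mapping.keys c \<union> {k}"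
        using keys_add[of c "frag_cmul n (frag_of k)"] keys_cmul[of n "frag_of k"] by auto
      then show "?h x \<in> carrier (free_Abelian_group {..<Suc k})"
        using x by auto
    qed
    show "(\<lambda>c. (c - frag_cmul (Poly_Mapping.lookup c k) (frag_of k), Poly_Mapping.lookup c k))
      \<in> carrier (free_Abelian_group {..<Suc k}) \<rightarrow> carrier (free_Abelian_group {..<k} \<times>\<times> integer_group)"
    proof
      fix c assume c: "c \<in> carrier (free_Abelian_group {..<Suc k})"
      have "Poly_Mapping.keys (c - frag_cmul (Poly_Mapping.lookup c k) (frag_of k)) \<subseteq> {..<k}"
      proof
        fix i assume i: "i \<in> Poly_Mapping.keys (c - frag_cmul (Poly_Mapping.lookup c k) (frag_of k))"
        then have "i \<noteq> k"
          by (auto simp: in_keys_iff lookup_minus)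
        moreover have "i \<in> Poly_Mapping.keys c"
          using i \<open>i \<noteq> k\<close> by (auto simp: in_keys_iff lookup_minus lookup_frag_of)
        ultimately show "i \<in> {..<k}" using c by (auto simp: less_Suc_eq)
      qed
      then show "(c - frag_cmul (Poly_Mapping.lookup c k) (frag_of k), Poly_Mapping.lookup c k)
        \<in> carrier (free_Abelian_group {..<k} \<times>\<times> integer_group)" by (simp add: integer_group_def)
    qed
  next
    fix x assume "x \<in> carrier (free_Abelian_group {..<k} \<times>\<times> integer_group)"
    then obtain c n where x: "x = (c, n)" "Poly_Mapping.keys c \<subseteq> {..<k}" by auto
    then have "Poly_Mapping.lookup c k = 0" by (auto simp: in_keys_iff)
    then show "(\<lambda>c. (c - frag_cmul (Poly_Mapping.lookup c k) (frag_of k), Poly_Mapping.lookup c k)) (?h x) = x"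
      using x by (simp add: lookup_add)
  qed auto
qed

text \<open>Index sets of the form \<open>{..<k}\<close> make no reference to elements of
  \<open>G\<close>, so the property passes along isomorphisms between groups of different
  types.\<close>

definition finite_rank_free :: "('a, 'b) monoid_scheme \<Rightarrow> bool" where
  "finite_rank_free G \<longleftrightarrow> (\<exists>k::nat. free_Abelian_group {..<k} \<cong> G)"

text \<open>The images of the generators under the isomorphism form a basis \<open>B\<close> inside
  the carrier, equipotent to \<open>{..<k}\<close> by injectivity.\<close>

lemma finite_rank_free_imp_free_abelian:
  assumes "finite_rank_free G" "comm_group G"
  shows "free_abelian G"
proof -
  obtain k h where h: "h \<in> iso (free_Abelian_group {..<k::nat}) G"
    using assms(1) by (auto simp: finite_rank_free_def is_iso_def)
  define B where "B = (h \<circ> frag_of) ` {..<k}"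
  have bij: "bij_betw h (carrier (free_Abelian_group {..<k})) (carrier G)"
    using h by (simp add: iso_def)
  have fo: "frag_of ` {..<k} \<subseteq> carrier (free_Abelian_group {..<k})" by auto
  have "B \<subseteq> carrier G"
    using bij_betw_imp_surj_on[OF bij] fo by (auto simp: B_def)
  have "inj_on (h \<circ> frag_of) {..<k}"
    by (rule comp_inj_on) (use bij fo in \<open>auto simp: bij_betw_def inj_on_def[of frag_of] frag_of_eq elim: inj_on_subset\<close>)
  then have "{..<k} \<approx> B" by (auto simp: B_def eqpoll_def bij_betw_def)
  then have "free_Abelian_group {..<k} \<cong> free_Abelian_group B"
    by (simp add: isomorphic_free_Abelian_groups)
  then have "G \<cong> free_Abelian_group B"
    using h by (meson group.iso_sym group_free_Abelian_group is_isoI iso_trans)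
  then show ?thesis using assms(2) \<open>B \<subseteq> carrier G\<close> by (auto simp: free_abelian_def)
qed

lemma finite_rank_free_trivial:
  assumes "trivial_group G" shows "finite_rank_free G"
proof -
  have "trivial_group (free_Abelian_group {..<0::nat})"
    unfolding trivial_group_def by (auto simp: subset_empty)
  then have "(\<lambda>_. \<one>\<^bsub>G\<^esub>) \<in> iso (free_Abelian_group {..<0::nat}) G"
    using assms by (auto simp: trivial_group_def iso_def hom_def bij_betw_def group.is_monoid)
  then have "free_Abelian_group {..<0::nat} \<cong> G"
    by (rule is_isoI)
  then show ?thesis unfolding finite_rank_free_def by blast
qed

lemma finite_rank_free_iso:
  assumes "finite_rank_free G" "G \<cong> H" shows "finite_rank_free H"
  using assms iso_trans unfolding finite_rank_free_def by blast

text \<open>The image of \<open>B\<close> in \<open>C\<close> is, up to isomorphism, a subgroup of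
  the integers, hence zero or infinite cyclic. In the second case the surjection onto it splits, so
  \<open>B\<close> is \<open>A\<close> with one infinite cyclic summand added.\<close>

lemma finite_rank_free_extension:
  assumes ex: "exact_seq ([C, B, A], [g, f])" and inj: "inj_on f (carrier A)"
    and A: "finite_rank_free A" and C: "trivial_group C \<or> C \<cong> integer_group"
    and comm: "comm_group B"
  shows "finite_rank_free B"
proof -
  have f: "group_hom A B f" and g: "group_hom B C g" and k: "kernel B C g = f ` carrier A"
    using ex by (auto simp: group_hom_def group_hom_axioms_def)
  interpret f: group_hom A B f by fact
  interpret g: group_hom B C g by fact
  interpret B: comm_group B by fact
  \<comment> \<open>Both alternatives for \<open>C\<close> are merged into one homomorphism to the
    integers whose kernel is the image of \<open>f\<close>; for trivial \<open>C\<close> it is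
    zero.\<close>
  obtain \<psi> where \<psi>: "\<psi> \<in> hom B integer_group" and ker: "\<And>b. b \<in> carrier B \<Longrightarrow> \<psi> b = 0 \<longleftrightarrow> b \<in> f ` carrier A"
    using C
  proof
    assume "trivial_group C"
    then have "kernel B C g = carrier B"
      using g by (simp add: group_hom.kernel_to_trivial_group)
    then show thesis using k by (intro that[of "\<lambda>_. 0"]) (auto simp: hom_def integer_group_def)
  next
    assume "C \<cong> integer_group"
    then obtain j where j: "j \<in> iso C integer_group" by (auto simp: is_iso_def)
    have jh: "j \<in> hom C integer_group" and ji: "inj_on j (carrier C)"
      using j by (auto simp: iso_def bij_betw_def)
    have j1: "j \<one>\<^bsub>C\<^esub> = 0" using hom_one[OF jh] \<open>group_hom B C g\<close> by (simp add: group_hom_def)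
    have "j (g b) = 0 \<longleftrightarrow> g b = \<one>\<^bsub>C\<^esub>" if "b \<in> carrier B" for b
      using that inj_onD[OF ji, of "g b" "\<one>\<^bsub>C\<^esub>"] j1 by auto
    then show thesis
      using k by (intro that[of "j \<circ> g"] hom_compose[OF g.homh jh]) (auto simp: kernel_def)
  qed
  have \<psi>_mult: "\<psi> (x \<otimes>\<^bsub>B\<^esub> y) = \<psi> x + \<psi> y" if "x \<in> carrier B" "y \<in> carrier B" for x y
    using hom_mult[OF \<psi> that] by (simp add: integer_group_def)
  interpret \<psi>: group_hom B integer_group \<psi>
    using \<psi> by (simp add: group_hom_def group_hom_axioms_def)
  have \<psi>_pow: "\<psi> (x [^]\<^bsub>B\<^esub> (n::int)) = n * \<psi> x" if "x \<in> carrier B" for x n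
    using \<psi>.hom_int_pow[OF that, of n] by simp
  have \<psi>_inv: "\<psi> (inv\<^bsub>B\<^esub> x) = - \<psi> x" if "x \<in> carrier B" for x
    using \<psi>.hom_inv[OF that] by simp
  show ?thesis
  proof (cases "\<forall>b\<in>carrier B. \<psi> b = 0")
    case True
    then have "f ` carrier A = carrier B" using ker by auto
    then have "f \<in> iso A B" using inj f.homh by (simp add: iso_def bij_betw_def)
    then show ?thesis using A finite_rank_free_iso is_isoI by blast
  next
    case False
    \<comment> \<open>\<open>d\<close> generates the image of \<open>\<psi>\<close>; an element
      \<open>e\<close> over \<open>d\<close> will span a complement of the image of
      \<open>f\<close>.\<close>
    define d where "d = (LEAST n. 0 < n \<and> (\<exists>b\<in>carrier B. \<psi> b = int n))"
    have "\<exists>n>0. \<exists>b\<in>carrier B. \<psi> b = int n"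
    proof -
      obtain b where b: "b \<in> carrier B" "\<psi> b \<noteq> 0" using False by auto
      show ?thesis
      proof (cases "\<psi> b > 0")
        case True then show ?thesis using b by (intro exI[of _ "nat (\<psi> b)"]) auto
      next
        case False
        then show ?thesis using b
          by (intro exI[of _ "nat (- \<psi> b)"] conjI bexI[of _ "inv\<^bsub>B\<^esub> b"]) (auto simp: \<psi>_inv)
      qed
    qed
    from LeastI_ex[OF this] obtain e where d: "d > 0" and e: "e \<in> carrier B" "\<psi> e = int d"
      unfolding d_def by auto
    have dvd: "int d dvd \<psi> b" if b: "b \<in> carrier B" for b
    proof (rule ccontr)
      assume "\<not> int d dvd \<psi> b"
      \<comment> \<open>Euclidean division by \<open>d\<close>: the remainder is again a value of
        \<open>\<psi>\<close>, positive and smaller than \<open>d\<close>.\<close>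
      define b' where "b' = b \<otimes>\<^bsub>B\<^esub> e [^]\<^bsub>B\<^esub> (- (\<psi> b div int d))"
      have b': "b' \<in> carrier B" using b e by (simp add: b'_def)
      have "\<psi> b' = \<psi> b mod int d"
        using b e by (simp add: b'_def \<psi>_mult \<psi>_pow minus_div_mult_eq_mod[symmetric])
      moreover have "\<psi> b mod int d \<noteq> 0" using \<open>\<not> int d dvd \<psi> b\<close> by (simp add: dvd_eq_mod_eq_0)
      moreover have "\<psi> b mod int d \<ge> 0" "\<psi> b mod int d < int d" using d by auto
      ultimately have "0 < nat (\<psi> b mod int d) \<and> (\<exists>b\<in>carrier B. \<psi> b = int (nat (\<psi> b mod int d)))"
          "nat (\<psi> b mod int d) < d"
        using b' by (auto intro!: bexI[of _ b'])
      then show False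
        using not_less_Least[of "nat (\<psi> b mod int d)" "\<lambda>n. 0 < n \<and> (\<exists>b\<in>carrier B. \<psi> b = int n)"]
        b' \<open>\<psi> b' = _\<close> unfolding d_def by auto
    qed
    define h where "h = (\<lambda>(a, n::int). f a \<otimes>\<^bsub>B\<^esub> e [^]\<^bsub>B\<^esub> n)"
    have \<psi>f: "\<psi> (f a) = 0" if "a \<in> carrier A" for a using that ker by auto
    have "h \<in> iso (A \<times>\<times> integer_group) B"
    proof (rule isoI)
      show "h \<in> hom (A \<times>\<times> integer_group) B"
        by (rule homI) (use e in \<open>auto simp: h_def integer_group_def f.H.int_pow_mult B.m_ac\<close>)
      show "bij_betw h (carrier (A \<times>\<times> integer_group)) (carrier B)"
      proof (rule bij_betw_imageI)
        show "inj_on h (carrier (A \<times>\<times> integer_group))"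
        proof (rule inj_onI, clarsimp simp: h_def)
          fix a a' and n n' :: int assume a: "a \<in> carrier A" "a' \<in> carrier A"
            and eq: "f a \<otimes>\<^bsub>B\<^esub> e [^]\<^bsub>B\<^esub> n = f a' \<otimes>\<^bsub>B\<^esub> e [^]\<^bsub>B\<^esub> (n'::int)"
          from arg_cong[OF eq, of \<psi>] have "n * int d = n' * int d"
            using a e by (simp add: \<psi>_mult \<psi>_pow \<psi>f)
          then have n: "n = n'" using d by simp
          then have "f a = f a'" using eq a e by simp
          then show "a = a' \<and> n = n'" using inj a n by (auto dest: inj_onD)
        qed
        show "h ` carrier (A \<times>\<times> integer_group) = carrier B"
        proof
          show "h ` carrier (A \<times>\<times> integer_group) \<subseteq> carrier B" using e by (auto simp: h_def)
          show "carrier B \<subseteq> h ` carrier (A \<times>\<times> integer_group)"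
          proof
            fix b assume b: "b \<in> carrier B"
            obtain q where q: "\<psi> b = int d * q" using dvd[OF b] by (auto elim: dvdE)
            define c where "c = b \<otimes>\<^bsub>B\<^esub> e [^]\<^bsub>B\<^esub> (- q)"
            have "c \<in> carrier B" "\<psi> c = 0" using b e q by (auto simp: c_def \<psi>_mult \<psi>_pow)
            then obtain a where a: "a \<in> carrier A" "c = f a" using ker by auto
            have "h (a, q) = b"
              unfolding h_def prod.case a(2)[symmetric] c_def
              using b e by (simp add: f.H.m_assoc f.H.int_pow_neg)
            then show "b \<in> h ` carrier (A \<times>\<times> integer_group)"
              using a by (intro image_eqI[of _ _ "(a, q)"]) (auto simp: integer_group_def)
          qed
        qed
      qed
    qed
    then have 1: "A \<times>\<times> integer_group \<cong> B" by (rule is_isoI)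
    obtain m where m: "free_Abelian_group {..<m::nat} \<cong> A" using A by (auto simp: finite_rank_free_def)
    have "free_Abelian_group {..<m} \<times>\<times> integer_group \<cong> A \<times>\<times> integer_group"
      by (rule group.DirProd_iso_trans[OF _ m iso_refl]) auto
    moreover have "free_Abelian_group {..<Suc m} \<cong> free_Abelian_group {..<m} \<times>\<times> integer_group"
      by (rule group.iso_sym) (auto intro: DirProd_group is_isoI[OF free_Abelian_group_Suc_iso])
    ultimately have "free_Abelian_group {..<Suc m} \<cong> B"
      using 1 by (meson iso_trans)
    then show ?thesis unfolding finite_rank_free_def by blast
  qed
qed

section \<open>Geometric realizations\<close>

definition simplicial_complex :: "'a set set \<Rightarrow> bool" where
  "simplicial_complex K \<longleftrightarrow> (\<forall>s\<in>K. finite s \<and> s \<noteq> {}) \<and> (\<forall>s\<in>K. \<forall>t. t \<subseteq> s \<and> t \<noteq> {} \<longrightarrow> t \<in> K)"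

lemma simplicial_complexD:
  assumes "simplicial_complex K" "s \<in> K"
  shows "finite s" "s \<noteq> {}" "\<And>t. t \<subseteq> s \<Longrightarrow> t \<noteq> {} \<Longrightarrow> t \<in> K"
  using assms unfolding simplicial_complex_def by blast+

text \<open>The point set underlying \<open>geometric_realization K\<close>, named separately
  because the second member of a topological pair is a set.\<close>

definition polyhedron :: "'a set set \<Rightarrow> ('a \<Rightarrow> real) set" where
  "polyhedron K = {t. (\<forall>v. 0 \<le> t v) \<and> {v. t v \<noteq> 0} \<in> K \<and> (\<Sum>v\<in>{v. t v \<noteq> 0}. t v) = 1}"

text \<open>The complement of the open star of \<open>s\<close>. If \<open>K\<close> is the full
  simplex on \<open>s\<close>, this is its boundary.\<close>

definition avoiding :: "'a set set \<Rightarrow> 'a set \<Rightarrow> 'a set set" where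
  "avoiding K s = {t \<in> K. \<not> s \<subseteq> t}"

text \<open>The product topology is the type-class topology on functions, so maps into realizations
  can be treated with \<open>continuous_on\<close>.\<close>

lemma geometric_realization_eq: "geometric_realization K = top_of_set (polyhedron K)"
  unfolding geometric_realization_def polyhedron_def by (simp only: euclidean_product_topology)

lemma topspace_geometric_realization [simp]: "topspace (geometric_realization K) = polyhedron K"
  by (simp add: geometric_realization_eq)

lemma polyhedron_mono: "L \<subseteq> K \<Longrightarrow> polyhedron L \<subseteq> polyhedron K"
  by (auto simp: polyhedron_def)

lemma subtopology_geometric_realization:
  "S \<subseteq> polyhedron K \<Longrightarrow> subtopology (geometric_realization K) S = top_of_set S"
  by (simp add: geometric_realization_eq subtopology_subtopology Int_absorb1)

lemma subtopology_subcomplex: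
  "L \<subseteq> K \<Longrightarrow> subtopology (geometric_realization K) (polyhedron L) = geometric_realization L"
  by (simp add: subtopology_geometric_realization polyhedron_mono) (simp add: geometric_realization_eq)

lemma polyhedron_empty [simp]: "polyhedron {} = {}"
  by (auto simp: polyhedron_def)

lemma simplicial_complex_avoiding:
  "simplicial_complex K \<Longrightarrow> simplicial_complex (avoiding K s)"
  unfolding simplicial_complex_def avoiding_def by (blast intro: order_trans)

lemma avoiding_subset: "avoiding K s \<subseteq> K"
  by (auto simp: avoiding_def)

lemma polyhedronI:
  assumes "simplicial_complex K" "s \<in> K" "\<And>v. 0 \<le> t v" "\<And>v. v \<notin> s \<Longrightarrow> t v = 0" "sum t s = 1"
  shows "t \<in> polyhedron K"
proof -
  have sub: "{v. t v \<noteq> 0} \<subseteq> s" using assms(4) by auto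
  have "finite s" using assms simplicial_complexD by blast
  have sum: "sum t {v. t v \<noteq> 0} = 1"
    using sum.mono_neutral_left[OF \<open>finite s\<close> sub, of t] assms(5) by auto
  then have "{v. t v \<noteq> 0} \<noteq> {}" by (metis sum.empty zero_neq_one)
  then have "{v. t v \<noteq> 0} \<in> K"
    using simplicial_complexD(3)[OF assms(1,2) sub] by simp
  then show ?thesis
    using sum assms(3) by (simp add: polyhedron_def)
qed

lemma polyhedronD:
  assumes "t \<in> polyhedron K"
  shows "0 \<le> t v" "{v. t v \<noteq> 0} \<in> K" "sum t {v. t v \<noteq> 0} = 1"
  using assms by (auto simp: polyhedron_def)

lemma polyhedron_sum:
  assumes "t \<in> polyhedron K" "finite s" "{v. t v \<noteq> 0} \<subseteq> s"
  shows "sum t s = 1"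
  using polyhedronD(3)[OF assms(1)] sum.mono_neutral_left[OF assms(2,3), of t] by auto

lemma polyhedron_segment:
  assumes K: "simplicial_complex K" and t: "t \<in> polyhedron K" "u \<in> polyhedron K"
    and s: "s \<in> K" "{v. t v \<noteq> 0} \<subseteq> s" "{v. u v \<noteq> 0} \<subseteq> s" and a: "0 \<le> a" "a \<le> 1"
  shows "(\<lambda>v. (1 - a) * t v + a * u v) \<in> polyhedron K"
proof (rule polyhedronI[OF K s(1)])
  have "finite s" using K s simplicial_complexD by blast
  then have "sum t s = 1" "sum u s = 1" using polyhedron_sum t s by blast+
  then show "(\<Sum>v\<in>s. (1 - a) * t v + a * u v) = 1"
    by (simp add: sum.distrib sum_distrib_left[symmetric])
  show "0 \<le> (1 - a) * t v + a * u v" for v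
    using a polyhedronD(1)[OF t(1)] polyhedronD(1)[OF t(2)]
    by (intro add_nonneg_nonneg mult_nonneg_nonneg) auto
  show "(1 - a) * t v + a * u v = 0" if "v \<notin> s" for v
  proof -
    have "t v = 0" "u v = 0" using s(2,3) that by auto
    then show ?thesis by simp
  qed
qed

section \<open>Straight-line homotopies and continuity of coordinates\<close>

lemma homotopic_with_straight_line:
  fixes f g :: "'b::topological_space \<Rightarrow> 'a \<Rightarrow> real"
  assumes f: "continuous_on S f" and g: "continuous_on S g"
    and seg: "\<And>x a. x \<in> S \<Longrightarrow> 0 \<le> a \<Longrightarrow> a \<le> 1 \<Longrightarrow> (\<lambda>v. (1 - a) * f x v + a * g x v) \<in> T"
  shows "homotopic_with (\<lambda>h. True) (top_of_set S) (top_of_set T) f g"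
proof -
  let ?h = "\<lambda>z v. (1 - fst z) * f (snd z) v + fst z * g (snd z) v"
  have "continuous_on ({0..1} \<times> S) ?h"
  proof (rule continuous_on_coordinatewise_then_product)
    fix v
    have *: "continuous_on ({0..1} \<times> S) (\<lambda>z. k (snd z) v)" if "continuous_on S k" for k :: "'b \<Rightarrow> 'a \<Rightarrow> real"
      by (rule continuous_on_compose2[OF continuous_on_product_then_coordinatewise[OF that] continuous_on_snd[OF continuous_on_id]])
        auto
    show "continuous_on ({0..1} \<times> S) (\<lambda>z. ?h z v)"
      by (intro continuous_intros *[OF f] *[OF g])
  qed
  moreover have "?h \<in> {0..1} \<times> S \<rightarrow> T" using seg by auto
  ultimately show ?thesis
    unfolding homotopic_with_def
    by (intro exI[of _ ?h]) (auto simp: prod_topology_subtopology_eu continuous_map_subtopology_eu fun_eq_iff)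
qed

lemma continuous_on_coordinate:
  fixes S :: "('a \<Rightarrow> real) set"
  shows "continuous_on S (\<lambda>t. t v)"
  by (rule continuous_on_subset[OF continuous_on_product_coordinates subset_UNIV])

lemma continuous_on_Min:
  fixes f :: "'i \<Rightarrow> 'b::topological_space \<Rightarrow> real"
  assumes "finite I" "I \<noteq> {}" "\<And>i. i \<in> I \<Longrightarrow> continuous_on S (f i)"
  shows "continuous_on S (\<lambda>x. Min ((\<lambda>i. f i x) ` I))"
  using assms by (induction I rule: finite_ne_induct) (auto intro: continuous_on_min)

section \<open>Barycenters and local homology\<close>

definition barycenter :: "'a set \<Rightarrow> 'a \<Rightarrow> real" where
  "barycenter s = (\<lambda>v. if v \<in> s then 1 / real (card s) else 0)"

lemma barycenter_in_polyhedron: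
  assumes "simplicial_complex K" "s \<in> K" shows "barycenter s \<in> polyhedron K"
proof -
  have "finite s" "s \<noteq> {}" using assms simplicial_complexD by blast+
  then have "sum (barycenter s) s = 1" by (simp add: barycenter_def)
  moreover have "0 \<le> barycenter s v" for v by (simp add: barycenter_def)
  moreover have "barycenter s v = 0" if "v \<notin> s" for v using that by (simp add: barycenter_def)
  ultimately show ?thesis by (rule polyhedronI[OF assms, rotated 2])
qed

lemma barycenter_notin_avoiding:
  assumes "simplicial_complex K" "s \<in> K" shows "barycenter s \<notin> polyhedron (avoiding K s)"
proof -
  have "finite s" using assms simplicial_complexD by blast
  then have "s \<subseteq> {v. barycenter s v \<noteq> 0}" by (auto simp: barycenter_def)
  then show ?thesis by (simp add: polyhedron_def avoiding_def)
qed

text \<open>The retraction moves a point radially away from the barycenter until the first barycentric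
  coordinate belonging to the simplex vanishes.\<close>

lemma punctured_polyhedron_retraction_trivial:
  assumes K: "simplicial_complex K" and s: "s \<in> K"
  shows "trivial_group (relative_homology_group p (subtopology (geometric_realization K) (polyhedron K - {barycenter s}))
     (polyhedron (avoiding K s)))"
proof -
  let ?b = "barycenter s"
  let ?Y = "polyhedron K - {?b}"
  let ?L = "polyhedron (avoiding K s)"
  have fin: "finite s" "s \<noteq> {}" using K s simplicial_complexD by blast+
  have cs: "real (card s) > 0" using fin by (simp add: card_gt_0_iff)
  \<comment> \<open>\<open>m t\<close> is the largest weight with which the barycenter can be split
    off from \<open>t\<close>: \<open>t v = m t * ?b v + (1 - m t) * f t v\<close> with
    \<open>f t\<close> nonnegative. The factor \<open>card s\<close> scales the nonzero coordinates
    of the barycenter to 1.\<close>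
  define m where "m = (\<lambda>t. Min ((\<lambda>v. real (card s) * t v) ` s))"
  define f where "f = (\<lambda>t v. (t v - m t * ?b v) / (1 - m t))"
  have m_le: "m t * ?b v \<le> t v" if "t \<in> polyhedron K" for t v
  proof (cases "v \<in> s")
    case True
    then have "m t \<le> real (card s) * t v" using fin by (simp add: m_def)
    then show ?thesis using True cs by (simp add: barycenter_def field_simps)
  qed (use polyhedronD(1)[OF that] in \<open>simp add: barycenter_def\<close>)
  have m_nonneg: "0 \<le> m t" if "t \<in> polyhedron K" for t
  proof -
    have "0 \<le> real (card s) * t v" for v
      by (rule mult_nonneg_nonneg[OF of_nat_0_le_iff polyhedronD(1)[OF that]])
    then show ?thesis unfolding m_def using fin by simp
  qed
  \<comment> \<open>If \<open>m t\<close> were at least 1, then \<open>t\<close> would dominate the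
    barycenter in every coordinate; as both sum to 1, they would agree.\<close>
  have m_lt: "m t < 1" if t: "t \<in> ?Y" for t
  proof (rule ccontr)
    assume "\<not> m t < 1"
    let ?s = "s \<union> {v. t v \<noteq> 0}"
    have finS: "finite ?s" using t polyhedronD(2) simplicial_complexD(1)[OF K] fin by blast
    have ge: "?b v \<le> t v" for v
      using m_le[of t v] t \<open>\<not> m t < 1\<close> mult_right_mono[of 1 "m t" "?b v"] by (auto simp: barycenter_def)
    have "sum t ?s = 1" using t by (intro polyhedron_sum[OF _ finS]) auto
    moreover have "sum ?b ?s = 1"
      using barycenter_in_polyhedron[OF K s] by (intro polyhedron_sum[OF _ finS]) (auto simp: barycenter_def)
    ultimately have "(\<Sum>v\<in>?s. t v - ?b v) = 0" by (simp add: sum_subtractf)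
    moreover have "0 \<le> t v - ?b v" for v using ge[of v] by simp
    ultimately have eq: "\<forall>v\<in>?s. t v - ?b v = 0"
      using sum_nonneg_eq_0_iff[OF finS, of "\<lambda>v. t v - ?b v"] by metis
    have "t v = ?b v" for v
    proof (cases "v \<in> ?s")
      case True then show ?thesis using eq by (metis eq_iff_diff_eq_0)
    next
      case False then show ?thesis by (simp add: barycenter_def)
    qed
    then have "t = ?b" by (rule ext)
    then show False using t by simp
  qed
  have supp: "{v. f t v \<noteq> 0} \<subseteq> {v. t v \<noteq> 0}" if t: "t \<in> ?Y" for t
  proof
    fix v assume v: "v \<in> {v. f t v \<noteq> 0}"
    have "t v \<noteq> 0"
    proof
      assume 0: "t v = 0"
      then have "m t * ?b v \<noteq> 0" using v by (auto simp: f_def)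
      moreover have "m t * ?b v \<le> 0" using m_le[of t v] t 0 by simp
      moreover have "0 \<le> m t * ?b v" using m_nonneg[of t] t by (simp add: barycenter_def)
      ultimately show False by linarith
    qed
    then show "v \<in> {v. t v \<noteq> 0}" by simp
  qed
  have f_K: "f t \<in> polyhedron K" if t: "t \<in> ?Y" for t
  proof (rule polyhedronI[OF K])
    show "{v. t v \<noteq> 0} \<in> K" using t polyhedronD(2) by blast
    show "0 \<le> f t v" for v using m_le[of t v] m_lt[of t] t by (simp add: f_def)
    show "f t v = 0" if "v \<notin> {v. t v \<noteq> 0}" for v using supp[OF t] that by auto
    have "finite {v. t v \<noteq> 0}" using t polyhedronD(2) simplicial_complexD(1)[OF K] by blast
    show "sum (f t) {v. t v \<noteq> 0} = 1"
    \<comment> \<open>For \<open>m t = 0\<close> the point does not move. Otherwise the support of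
      \<open>t\<close> contains \<open>s\<close>, so that the barycenter sums to 1 over it.\<close>
    proof (cases "m t = 0")
      case True
      then show ?thesis using t polyhedronD(3)[of t K] by (simp add: f_def)
    next
      case False
      have "s \<subseteq> {v. t v \<noteq> 0}"
      proof
        fix v assume "v \<in> s"
        then have "0 < m t * ?b v" using m_nonneg[of t] t False cs by (simp add: barycenter_def)
        then show "v \<in> {v. t v \<noteq> 0}" using m_le[of t v] t by auto
      qed
      then have "sum ?b {v. t v \<noteq> 0} = 1"
        using \<open>finite {v. t v \<noteq> 0}\<close> barycenter_in_polyhedron[OF K s]
        by (intro polyhedron_sum) (auto simp: barycenter_def)
      then show ?thesis
        using polyhedronD(3)[of t K] t m_lt[OF t]
        by (simp add: f_def sum_divide_distrib[symmetric] sum_subtractf sum_distrib_left[symmetric])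
    qed
  qed
  have f_L: "f t \<in> ?L" if t: "t \<in> ?Y" for t
  proof -
    have "m t \<in> (\<lambda>v. real (card s) * t v) ` s" using fin unfolding m_def by (intro Min_in) auto
    then obtain v where "v \<in> s" "m t = real (card s) * t v" by auto
    then have "f t v = 0" using cs by (simp add: f_def barycenter_def)
    then have "\<not> s \<subseteq> {v. f t v \<noteq> 0}" using \<open>v \<in> s\<close> by auto
    then show ?thesis using f_K[OF t] by (simp add: polyhedron_def avoiding_def)
  qed
  have LY: "?L \<subseteq> ?Y"
    using polyhedron_mono[OF avoiding_subset[of K s]] barycenter_notin_avoiding[OF K s] by auto
  have m_L: "m t = 0" if t: "t \<in> ?L" for t
  proof -
    obtain v where v: "v \<in> s" "t v = 0" using t by (auto simp: polyhedron_def avoiding_def)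
    then have "m t \<le> real (card s) * t v" unfolding m_def using fin by (intro Min_le) auto
    then show ?thesis using v m_nonneg[of t] t LY by auto
  qed
  have contm: "continuous_on ?Y m"
    unfolding m_def using fin by (intro continuous_on_Min continuous_intros continuous_on_coordinate)
  have contf: "continuous_on ?Y f"
    unfolding f_def
  proof (rule continuous_on_coordinatewise_then_product)
    fix v show "continuous_on ?Y (\<lambda>t. (t v - m t * ?b v) / (1 - m t))"
      using m_lt by (intro continuous_intros contm continuous_on_coordinate) force
  qed
  have *: "subtopology (geometric_realization K) ?Y = top_of_set ?Y"
    by (rule subtopology_geometric_realization) auto
  have **: "subtopology (top_of_set ?Y) ?L = top_of_set ?L"
    using LY by (simp add: subtopology_subtopology Int_absorb1)
  have fL: "f t = t" if "t \<in> ?L" for t using m_L[OF that] by (auto simp: f_def)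
  show ?thesis
    unfolding *
  proof (rule trivial_relative_homology_group_gen)
    show "continuous_map (top_of_set ?Y) (subtopology (top_of_set ?Y) ?L) f"
      unfolding ** using contf f_L by (auto simp: continuous_map_subtopology_eu)
    show "homotopic_with (\<lambda>h. True) (subtopology (top_of_set ?Y) ?L) (subtopology (top_of_set ?Y) ?L) f id"
      unfolding ** using fL by (intro homotopic_with_equal) (auto simp: continuous_map_subtopology_eu
         intro: continuous_on_subset[OF contf LY])
    show "homotopic_with (\<lambda>k. True) (top_of_set ?Y) (top_of_set ?Y) f id"
    proof (rule homotopic_with_straight_line[OF contf])
      fix t and a :: real assume t: "t \<in> ?Y" and a: "0 \<le> a" "a \<le> 1"
      let ?u = "\<lambda>v. (1 - a) * f t v + a * id t v"
      have "?u \<in> polyhedron K"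
        using t f_K[OF t] supp[OF t] a polyhedronD(2)[of t K] by (intro polyhedron_segment[OF K]) auto
      \<comment> \<open>The segment misses the barycenter: at a vertex \<open>v\<close> of
        \<open>s\<close> with \<open>f t v = 0\<close>, a hit would force
        \<open>a * m t = 1\<close>, although \<open>m t < 1\<close>. For \<open>a = 1\<close> the
        point is \<open>t\<close> itself.\<close>
      moreover have "?u \<noteq> ?b"
      proof
        assume "?u = ?b"
        then have u: "?b v = (1 - a) * f t v + a * t v" for v by (simp add: fun_eq_iff)
        show False
        proof (cases "a = 1")
          case True then show False using u t by (auto simp: fun_eq_iff)
        next
          case False
          obtain v where v: "v \<in> s" "f t v = 0" using f_L[OF t] by (auto simp: polyhedron_def avoiding_def)
          have "t v = m t * ?b v" using v m_lt[OF t] by (auto simp: f_def)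
          have "(1 - a * m t) * ?b v = ?b v - a * (m t * ?b v)" by (simp add: algebra_simps)
          also have "\<dots> = ?b v - a * t v" using \<open>t v = m t * ?b v\<close> by simp
          also have "\<dots> = 0" using u[of v] v(2) by simp
          finally have "a * m t = 1" using v(1) cs by (simp add: barycenter_def)
          moreover have "a * m t \<le> m t" using a m_nonneg[of t] t by (simp add: mult_left_le_one_le)
          ultimately show False using m_lt[OF t] by simp
        qed
      qed
      ultimately show "?u \<in> ?Y" by simp
    qed auto
  qed
qed

text \<open>This turns local homology into data of the complex: by the retraction, the punctured
  polyhedron relative to the complement of the open star drops out of the triple's sequence.\<close>

lemma relative_homology_avoiding_iso_local:
  assumes "simplicial_complex K" "s \<in> K"
  shows "relative_homology_group p (geometric_realization K) (polyhedron (avoiding K s)) \<cong>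
    relative_homology_group p (geometric_realization K) (polyhedron K - {barycenter s})"
proof (rule relative_homology_iso_quotient)
  show "polyhedron (avoiding K s) \<subseteq> polyhedron K - {barycenter s}"
    using polyhedron_mono[OF avoiding_subset[of K s]] barycenter_notin_avoiding[OF assms] by auto
qed (intro punctured_polyhedron_retraction_trivial assms)+

text \<open>The part of \<open>polyhedron K\<close> outside \<open>A\<close> misses the open star of
  \<open>s\<close>, so its closure misses the barycenter and it can be excised.\<close>

lemma local_homology_subcomplex_iso:
  assumes K: "simplicial_complex K" and A: "A \<subseteq> K" "s \<in> A" and star: "\<And>t. t \<in> K \<Longrightarrow> s \<subseteq> t \<Longrightarrow> t \<in> A"
  shows "relative_homology_group p (geometric_realization A) (polyhedron A - {barycenter s}) \<cong>
    relative_homology_group p (geometric_realization K) (polyhedron K - {barycenter s})"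
proof -
  let ?X = "geometric_realization K" let ?b = "barycenter s"
  let ?O = "{t \<in> polyhedron K. \<forall>v\<in>s. 0 < t v}"
  have fin: "finite s" "s \<noteq> {}" using K A simplicial_complexD by blast+
  have pA: "polyhedron A \<subseteq> polyhedron K" by (rule polyhedron_mono[OF A(1)])
  \<comment> \<open>\<open>?O\<close> is the open star of \<open>s\<close>, an open neighbourhood of
    the barycenter that stays inside \<open>polyhedron A\<close>.\<close>
  have "openin ?X ?O"
  proof -
    have "?O = polyhedron K \<inter> (\<Inter>v\<in>s. {t. 0 < t v})" using fin by auto
    moreover have "open (\<Inter>v\<in>s. {t::'a \<Rightarrow> real. 0 < t v})"
      using fin by (intro open_INT ballI open_Collect_less continuous_on_coordinate continuous_intros) auto
    ultimately show ?thesis unfolding geometric_realization_eq openin_open by blast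
  qed
  have OA: "?O \<subseteq> polyhedron A"
  proof
    fix t assume t: "t \<in> ?O"
    then have "s \<subseteq> {v. t v \<noteq> 0}" by force
    then show "t \<in> polyhedron A" using t star unfolding polyhedron_def by blast
  qed
  have bO: "?b \<in> ?O"
    using barycenter_in_polyhedron[OF K] A fin by (auto simp: barycenter_def card_gt_0_iff)
  have "closedin ?X {?b}"
  proof -
    have "{?b} = (\<Inter>v. {t. t v = ?b v})" by (auto simp: fun_eq_iff)
    moreover have "closed (\<Inter>v. {t. t v = ?b v})"
      by (intro closed_INT ballI closed_Collect_eq continuous_on_coordinate continuous_intros)
    ultimately have "closed {?b}" by simp
    then show ?thesis
      using bO unfolding geometric_realization_eq by (intro closed_subset) auto
  qed
  then have "openin ?X (polyhedron K - {?b})"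
    using openin_diff[of ?X "polyhedron K" "{?b}"] openin_topspace[of ?X] by simp
  then have int: "?X interior_of (polyhedron K - {?b}) = polyhedron K - {?b}" by (simp add: interior_of_openin)
  have "closedin ?X (polyhedron K - ?O)"
    using closedin_diff[OF closedin_topspace \<open>openin ?X ?O\<close>] by simp
  then have "?X closure_of (polyhedron K - polyhedron A) \<subseteq> polyhedron K - ?O"
    using OA by (intro closure_of_minimal) auto
  also have "\<dots> \<subseteq> polyhedron K - {?b}" using bO by auto
  finally have "?X closure_of (polyhedron K - polyhedron A) \<subseteq> ?X interior_of (polyhedron K - {?b})"
    by (simp add: int)
  from homology_excision_axiom[OF this, of "polyhedron K" p]
  have "relative_homology_group p (subtopology ?X (polyhedron K - (polyhedron K - polyhedron A)))
      (polyhedron K - {?b} - (polyhedron K - polyhedron A)) \<cong>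
    relative_homology_group p (subtopology ?X (polyhedron K)) (polyhedron K - {?b})"
    by (intro is_isoI) auto
  moreover have "polyhedron K - (polyhedron K - polyhedron A) = polyhedron A"
    "polyhedron K - {?b} - (polyhedron K - polyhedron A) = polyhedron A - {?b}"
    using pA by auto
  ultimately show ?thesis
    by (simp only: subtopology_subcomplex[OF A(1)] subtopology_subcomplex[OF order_refl])
qed

lemma excision_star_iso:
  assumes K: "simplicial_complex K" "simplicial_complex A" and A: "A \<subseteq> K" "s \<in> A"
    and star: "\<And>t. t \<in> K \<Longrightarrow> s \<subseteq> t \<Longrightarrow> t \<in> A"
  shows "relative_homology_group p (geometric_realization A) (polyhedron (avoiding A s)) \<cong>
    relative_homology_group p (geometric_realization K) (polyhedron (avoiding K s))"
proof -
  have "s \<in> K" using A by auto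
  have "relative_homology_group p (geometric_realization A) (polyhedron (avoiding A s)) \<cong>
    relative_homology_group p (geometric_realization A) (polyhedron A - {barycenter s})"
    by (rule relative_homology_avoiding_iso_local[OF K(2) A(2)])
  also have "\<dots> \<cong> relative_homology_group p (geometric_realization K) (polyhedron K - {barycenter s})"
    by (rule local_homology_subcomplex_iso[OF K(1) A star])
  also have "\<dots> \<cong> relative_homology_group p (geometric_realization K) (polyhedron (avoiding K s))"
    by (rule group.iso_sym[OF group_relative_homology_group relative_homology_avoiding_iso_local[OF K(1) \<open>s \<in> K\<close>]])
  finally show ?thesis .
qed

section \<open>Cones and joins\<close>

definition vertex_point :: "'a \<Rightarrow> 'a \<Rightarrow> real" where
  "vertex_point v = (\<lambda>w. if w = v then 1 else 0)"

lemma vertex_point_in_polyhedron: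
  assumes "{v} \<in> K" shows "vertex_point v \<in> polyhedron K"
proof -
  have "{w. vertex_point v w \<noteq> 0} = {v}" by (auto simp: vertex_point_def)
  then show ?thesis using assms by (simp add: polyhedron_def) (simp add: vertex_point_def)
qed

lemma homotopic_with_cone:
  assumes K: "simplicial_complex K" and v: "{v} \<in> K" and cone: "\<And>s. s \<in> K \<Longrightarrow> insert v s \<in> K"
  shows "homotopic_with (\<lambda>h. True) (geometric_realization K) (geometric_realization K) (\<lambda>_. vertex_point v) id"
  unfolding geometric_realization_eq
proof (rule homotopic_with_straight_line)
  fix t and a :: real assume t: "t \<in> polyhedron K" and a: "0 \<le> a" "a \<le> 1"
  show "(\<lambda>w. (1 - a) * vertex_point v w + a * id t w) \<in> polyhedron K"
    unfolding id_apply
    by (rule polyhedron_segment[OF K vertex_point_in_polyhedron[OF v] t cone[OF polyhedronD(2)[OF t]] _ _ a])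
       (auto simp: vertex_point_def)
qed auto

text \<open>The constant map to \<open>v\<close> is homotopic to the identity on each of the two
  cones, so the pair carries no homology.\<close>

lemma relative_homology_cones_trivial:
  assumes K: "simplicial_complex K" and L: "simplicial_complex L" "L \<subseteq> K" and v: "{v} \<in> L"
    and cone: "\<And>s. s \<in> K \<Longrightarrow> insert v s \<in> K" "\<And>s. s \<in> L \<Longrightarrow> insert v s \<in> L"
  shows "trivial_group (relative_homology_group p (geometric_realization K) (polyhedron L))"
proof (rule trivial_relative_homology_group_gen)
  have vK: "{v} \<in> K" using v L by blast
  show "continuous_map (geometric_realization K) (subtopology (geometric_realization K) (polyhedron L)) (\<lambda>_. vertex_point v)"
    using vertex_point_in_polyhedron[OF v] vertex_point_in_polyhedron[OF vK]
    by (simp add: continuous_map_in_subtopology)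
  show "homotopic_with (\<lambda>h. True) (subtopology (geometric_realization K) (polyhedron L))
     (subtopology (geometric_realization K) (polyhedron L)) (\<lambda>_. vertex_point v) id"
    unfolding subtopology_subcomplex[OF L(2)] by (rule homotopic_with_cone[OF L(1) v cone(2)])
  show "homotopic_with (\<lambda>k. True) (geometric_realization K) (geometric_realization K) (\<lambda>_. vertex_point v) id"
    by (rule homotopic_with_cone[OF K vK cone(1)])
qed

lemma polyhedron_singleton: "polyhedron {{v}} = {vertex_point v}"
proof
  show "polyhedron {{v}} \<subseteq> {vertex_point v}"
  proof
    fix t assume t: "t \<in> polyhedron {{v}}"
    have s: "{w. t w \<noteq> 0} = {v}" using polyhedronD(2)[OF t] by simp
    have "t v = 1" using polyhedronD(3)[OF t] by (simp add: s)
    moreover have "t w = 0" if "w \<noteq> v" for w using s that by auto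
    ultimately show "t \<in> {vertex_point v}" by (simp add: vertex_point_def fun_eq_iff)
  qed
qed (simp add: vertex_point_in_polyhedron)

text \<open>Relative to its apex the cone has no homology, and the apex, a single point, has
  homology only in degree 0.\<close>

lemma homology_cone_trivial:
  assumes K: "simplicial_complex K" and v: "{v} \<in> K" and cone: "\<And>s. s \<in> K \<Longrightarrow> insert v s \<in> K" and "p \<noteq> 0"
  shows "trivial_group (homology_group p (geometric_realization K))"
proof (rule relative_homology_trans_trivial)
  show "trivial_group (relative_homology_group p (geometric_realization K) (polyhedron {{v}}))"
    by (rule relative_homology_cones_trivial[OF K]) (use v cone in \<open>auto simp: simplicial_complex_def\<close>)
  have "trivial_group (homology_group p (geometric_realization {{v}}))"
    by (rule homology_dimension_axiom[OF _ \<open>p \<noteq> 0\<close>]) (simp add: polyhedron_singleton)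
  then show "trivial_group (homology_group p (subtopology (geometric_realization K) (polyhedron {{v}})))"
    using v by (simp add: subtopology_subcomplex)
qed auto

text \<open>The empty set is not a simplex here, so the apex \<open>{v}\<close> has to be added
  separately.\<close>

definition cone_complex :: "'a \<Rightarrow> 'a set set \<Rightarrow> 'a set set" where
  "cone_complex v K = insert {v} (K \<union> insert v ` K)"

lemma mem_cone_complex_iff:
  assumes "v \<notin> \<Union>K"
  shows "s \<in> cone_complex v K \<longleftrightarrow> s = {v} \<or> s \<in> K \<or> v \<in> s \<and> s - {v} \<in> K"
proof
  assume "s \<in> cone_complex v K" then show "s = {v} \<or> s \<in> K \<or> v \<in> s \<and> s - {v} \<in> K"
    using assms by (auto simp: cone_complex_def)
next
  assume "s = {v} \<or> s \<in> K \<or> v \<in> s \<and> s - {v} \<in> K"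
  then show "s \<in> cone_complex v K" unfolding cone_complex_def by (metis UnCI image_eqI insertCI insert_Diff)
qed

lemma simplicial_complex_cone_complex:
  assumes K: "simplicial_complex K" and v: "v \<notin> \<Union>K"
  shows "simplicial_complex (cone_complex v K)"
  unfolding simplicial_complex_def
proof (intro conjI ballI allI impI)
  fix s assume s: "s \<in> cone_complex v K"
  then show "finite s" "s \<noteq> {}"
    using simplicial_complexD(1,2)[OF K] by (auto simp: cone_complex_def)
  fix t assume t: "t \<subseteq> s \<and> t \<noteq> {}"
  show "t \<in> cone_complex v K"
  proof (cases "t = {v}")
    case False
    then have ne: "t - {v} \<noteq> {}" using t by auto
    from s have "s \<in> K \<or> s = {v} \<or> s - {v} \<in> K" using mem_cone_complex_iff[OF v] by auto
    moreover have "s \<noteq> {v}" using t False by (metis subset_singletonD)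
    moreover have "t - {v} \<subseteq> s - {v}" "t - {v} \<subseteq> s" using t by auto
    ultimately have "t - {v} \<in> K" using ne simplicial_complexD(3)[OF K] by metis
    then show ?thesis unfolding mem_cone_complex_iff[OF v] by (cases "v \<in> t") auto
  qed (simp add: cone_complex_def)
qed

lemma cone_complex_closed:
  assumes "s \<in> cone_complex v K" shows "insert v s \<in> cone_complex v K"
  using assms by (auto simp: cone_complex_def)

lemma cone_complex_mono: "L \<subseteq> K \<Longrightarrow> cone_complex v L \<subseteq> cone_complex v K"
  by (auto simp: cone_complex_def)

lemma simplicial_complex_Un:
  assumes "simplicial_complex K" "simplicial_complex L"
  shows "simplicial_complex (K \<union> L)"
  unfolding simplicial_complex_def
proof (intro conjI ballI allI impI)
  fix s assume s: "s \<in> K \<union> L"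
  then show "finite s" "s \<noteq> {}" using assms by (auto dest: simplicial_complexD(1,2))
  fix t assume "t \<subseteq> s \<and> t \<noteq> {}"
  then show "t \<in> K \<union> L"
    using s simplicial_complexD(3)[OF assms(1), of s t] simplicial_complexD(3)[OF assms(2), of s t] by blast
qed

text \<open>The triple consists of the cone over \<open>?L\<close>, then \<open>?M\<close>, then the
  cone over \<open>K\<close>. The outer pair consists of two cones and is trivial, so the connecting
  map lowers the degree by one from the upper pair to the lower one, and excision identifies the
  lower pair with \<open>K\<close> relative to \<open>?L\<close>.\<close>

lemma relative_homology_cone_iso:
  assumes K: "simplicial_complex K" and v: "v \<notin> \<Union>K" and s: "s \<in> K"
  shows "relative_homology_group p (geometric_realization K) (polyhedron (avoiding K s)) \<cong>
    relative_homology_group (p + 1) (geometric_realization (cone_complex v K))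
      (polyhedron (avoiding (cone_complex v K) (insert v s)))"
proof -
  let ?L = "avoiding K s"
  let ?M = "K \<union> cone_complex v ?L"
  have vs: "v \<notin> s" using v s by auto
  have L: "simplicial_complex ?L" by (rule simplicial_complex_avoiding[OF K])
  have vL: "v \<notin> \<Union>?L" using v avoiding_subset[of K s] by blast
  note cK = simplicial_complex_cone_complex[OF K v] and cL = simplicial_complex_cone_complex[OF L vL]
  have sub: "cone_complex v ?L \<subseteq> cone_complex v K" by (rule cone_complex_mono[OF avoiding_subset])
  have M: "simplicial_complex ?M"
    by (rule simplicial_complex_Un[OF K cL])
  have MK: "?M \<subseteq> cone_complex v K" using sub by (auto simp: cone_complex_def)
  \<comment> \<open>A simplex of the cone that misses a vertex of \<open>insert v s\<close> either
    lies in \<open>K\<close>, or contains \<open>v\<close> and has a remainder that does not contain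
    \<open>s\<close>.\<close>
  have eqM: "avoiding (cone_complex v K) (insert v s) = ?M"
  proof (intro equalityI subsetI)
    fix t assume t: "t \<in> avoiding (cone_complex v K) (insert v s)"
    then have tc: "t = {v} \<or> t \<in> K \<or> v \<in> t \<and> t - {v} \<in> K" and ns: "\<not> insert v s \<subseteq> t"
      using mem_cone_complex_iff[OF v] by (auto simp: avoiding_def)
    from tc show "t \<in> ?M"
    proof (elim disjE)
      assume a: "v \<in> t \<and> t - {v} \<in> K"
      then have "\<not> s \<subseteq> t - {v}" using ns by auto
      then have "t - {v} \<in> ?L" using a by (simp add: avoiding_def)
      then show ?thesis using a mem_cone_complex_iff[OF vL] by blast
    qed (auto simp: cone_complex_def)
  next
    fix t assume t: "t \<in> ?M"
    have "\<not> insert v s \<subseteq> t"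
    proof (cases "t \<in> K")
      case True then show ?thesis using v by auto
    next
      case False
      then have "t = {v} \<or> t \<in> ?L \<or> v \<in> t \<and> t - {v} \<in> ?L" using t mem_cone_complex_iff[OF vL] by auto
      moreover have "s \<noteq> {}" using K s simplicial_complexD(2) by blast
      ultimately show ?thesis using vs by (auto simp: avoiding_def)
    qed
    then show "t \<in> avoiding (cone_complex v K) (insert v s)" using t MK by (auto simp: avoiding_def)
  qed
  have eqL: "avoiding ?M s = cone_complex v ?L"
  proof (intro equalityI subsetI)
    fix t assume "t \<in> avoiding ?M s"
    then show "t \<in> cone_complex v ?L" by (auto simp: avoiding_def cone_complex_def)
  next
    fix t assume t: "t \<in> cone_complex v ?L"
    then have "t = {v} \<or> t \<in> ?L \<or> v \<in> t \<and> t - {v} \<in> ?L" using mem_cone_complex_iff[OF vL] by auto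
    moreover have "s \<noteq> {}" using K s simplicial_complexD(2) by blast
    ultimately have "\<not> s \<subseteq> t" using vs by (auto simp: avoiding_def)
    then show "t \<in> avoiding ?M s" using t by (simp add: avoiding_def)
  qed
  \<comment> \<open>A simplex of \<open>?M\<close> containing \<open>s\<close> is not in the cone
    over \<open>?L\<close>; so \<open>K\<close> holds the whole star of \<open>s\<close> in
    \<open>?M\<close>.\<close>
  have starM: "t \<in> K" if "t \<in> ?M" "s \<subseteq> t" for t
    using that eqL by (auto simp: avoiding_def)
  have "relative_homology_group p (geometric_realization K) (polyhedron (avoiding K s)) \<cong>
      relative_homology_group p (geometric_realization ?M) (polyhedron (cone_complex v ?L))"
    using excision_star_iso[OF M K _ s starM] unfolding eqL by simp
  also have "\<dots> \<cong> relative_homology_group (p + 1) (geometric_realization (cone_complex v K)) (polyhedron ?M)"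
  proof (rule group.iso_sym)
    have tr: "trivial_group (relative_homology_group q (geometric_realization (cone_complex v K)) (polyhedron (cone_complex v ?L)))" for q
      by (rule relative_homology_cones_trivial[OF cK cL sub, of v])
        (simp add: cone_complex_def, erule cone_complex_closed, erule cone_complex_closed)
    show "relative_homology_group (p + 1) (geometric_realization (cone_complex v K)) (polyhedron ?M) \<cong>
       relative_homology_group p (geometric_realization ?M) (polyhedron (cone_complex v ?L))"
      using relative_homology_iso_boundary[OF polyhedron_mono[of "cone_complex v ?L" ?M] tr tr[of "p + 1 - 1"]]
      unfolding subtopology_subcomplex[OF MK] by simp
  qed simp
  finally show ?thesis unfolding eqM .
qed

text \<open>The join of \<open>K\<close> with the full simplex on \<open>D\<close>, when
  \<open>D\<close> is disjoint from the vertices of \<open>K\<close>. The case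
  \<open>s - D = {}\<close> yields the faces of that simplex.\<close>

definition join_simplex :: "'a set set \<Rightarrow> 'a set \<Rightarrow> 'a set set" where
  "join_simplex K D = {s. s \<noteq> {} \<and> s - D \<in> insert {} K}"

lemma join_simplex_empty: "simplicial_complex K \<Longrightarrow> join_simplex K {} = K"
  by (auto simp: join_simplex_def simplicial_complex_def)

text \<open>This reduces joins to repeated coning, which allows induction over
  \<open>D\<close>.\<close>

lemma join_simplex_insert:
  assumes "v \<notin> D" "v \<notin> \<Union>K" "D \<inter> \<Union>K = {}"
  shows "join_simplex K (insert v D) = cone_complex v (join_simplex K D)"
proof -
  have vJ: "v \<notin> \<Union>(join_simplex K D)" using assms by (auto simp: join_simplex_def)
  show ?thesis
  proof (rule Set.set_eqI)
    fix s
    have "s - insert v D = s - {v} - D" by auto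
    moreover have "v \<notin> s \<Longrightarrow> s - {v} = s" by auto
    ultimately show "s \<in> join_simplex K (insert v D) \<longleftrightarrow> s \<in> cone_complex v (join_simplex K D)"
      unfolding mem_cone_complex_iff[OF vJ] using vJ by (cases "v \<in> s") (auto simp: join_simplex_def)
  qed
qed

text \<open>Induction over \<open>D\<close>: every added vertex cones off the complex and raises the
  degree by one. The first two conjuncts feed the next cone step.\<close>

lemma relative_homology_join_iso:
  assumes "finite D" and K: "simplicial_complex K" "s \<in> K" and "D \<inter> \<Union>K = {}"
  shows "simplicial_complex (join_simplex K D) \<and> s \<union> D \<in> join_simplex K D \<and>
    relative_homology_group p (geometric_realization K) (polyhedron (avoiding K s)) \<cong>
    relative_homology_group (p + int (card D)) (geometric_realization (join_simplex K D))
      (polyhedron (avoiding (join_simplex K D) (s \<union> D)))"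
  using assms(1,4)
proof (induction D rule: finite_induct)
  case empty
  then show ?case using K by (simp add: join_simplex_empty iso_refl)
next
  case (insert v D)
  let ?J = "join_simplex K D"
  have IH: "simplicial_complex ?J" "s \<union> D \<in> ?J"
    "relative_homology_group p (geometric_realization K) (polyhedron (avoiding K s)) \<cong>
    relative_homology_group (p + int (card D)) (geometric_realization ?J) (polyhedron (avoiding ?J (s \<union> D)))"
    using insert by auto
  have vJ: "v \<notin> \<Union>?J" using insert by (auto simp: join_simplex_def)
  have eq: "join_simplex K (insert v D) = cone_complex v ?J"
    by (rule join_simplex_insert) (use insert in auto)
  note IH(3)
  also have "relative_homology_group (p + int (card D)) (geometric_realization ?J) (polyhedron (avoiding ?J (s \<union> D)))
     \<cong> relative_homology_group (p + int (card D) + 1) (geometric_realization (cone_complex v ?J))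
      (polyhedron (avoiding (cone_complex v ?J) (insert v (s \<union> D))))"
    by (rule relative_homology_cone_iso[OF IH(1) vJ IH(2)])
  finally have "relative_homology_group p (geometric_realization K) (polyhedron (avoiding K s)) \<cong>
    relative_homology_group (p + int (card (insert v D))) (geometric_realization (join_simplex K (insert v D)))
      (polyhedron (avoiding (join_simplex K (insert v D)) (s \<union> insert v D)))"
    using insert by (simp add: eq algebra_simps)
  moreover have "simplicial_complex (join_simplex K (insert v D))"
    unfolding eq by (rule simplicial_complex_cone_complex[OF IH(1) vJ])
  moreover have "s \<union> insert v D \<in> join_simplex K (insert v D)"
    using IH(2) unfolding eq by (simp add: cone_complex_def)
  ultimately show ?case by blast
qed

section \<open>Relative homology below and above the dimension\<close>

text \<open>The full simplex on \<open>s\<close> is the join of one vertex with the others, so the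
  pair is a point relative to the empty set, shifted by \<open>card s - 1\<close> degrees.\<close>

lemma relative_homology_simplex_boundary:
  assumes "finite s" "s \<noteq> {}"
  defines "S \<equiv> {t. t \<subseteq> s \<and> t \<noteq> {}}"
  shows "p \<noteq> int (card s) - 1 \<Longrightarrow> trivial_group (relative_homology_group p (geometric_realization S) (polyhedron (avoiding S s)))"
    and "relative_homology_group (int (card s) - 1) (geometric_realization S) (polyhedron (avoiding S s)) \<cong> integer_group"
proof -
  obtain v where v: "v \<in> s" using assms by auto
  let ?D = "s - {v}"
  have K: "simplicial_complex {{v}}" by (auto simp: simplicial_complex_def)
  have S: "join_simplex {{v}} ?D = S" using v by (auto simp: join_simplex_def S_def)
  have u: "{v} \<union> ?D = s" using v by auto
  have c: "int (card ?D) = int (card s) - 1" using v assms by (simp add: of_nat_diff card_gt_0_iff Suc_leI)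
  have av: "avoiding {{v}} {v} = {}" by (auto simp: avoiding_def)
  have iso: "homology_group q (geometric_realization {{v}}) \<cong>
    relative_homology_group (q + (int (card s) - 1)) (geometric_realization S) (polyhedron (avoiding S s))" for q
    using relative_homology_join_iso[of ?D "{{v}}" "{v}" q] K assms(1) unfolding S u c av by simp
  have top: "topspace (geometric_realization {{v}}) = {vertex_point v}" by (simp add: polyhedron_singleton)
  show "trivial_group (relative_homology_group p (geometric_realization S) (polyhedron (avoiding S s)))"
    if "p \<noteq> int (card s) - 1"
    using isomorphic_group_triviality1[OF iso[of "p - (int (card s) - 1)"]] homology_dimension_axiom[OF top] that
    by simp
  show "relative_homology_group (int (card s) - 1) (geometric_realization S) (polyhedron (avoiding S s)) \<cong> integer_group"
    using group.iso_sym[OF _ iso[of 0]] homology_coefficients[OF top] iso_trans by fastforce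
qed

text \<open>Only \<open>s\<close> itself contains the maximal simplex \<open>s\<close>, so excision
  reduces the claim to a simplex and its boundary.\<close>

lemma relative_homology_add_simplex:
  assumes K: "simplicial_complex K" "s \<in> K" and max: "\<And>t. t \<in> K \<Longrightarrow> s \<subseteq> t \<Longrightarrow> t = s"
  shows "p \<noteq> int (card s) - 1 \<Longrightarrow> trivial_group (relative_homology_group p (geometric_realization K) (polyhedron (K - {s})))"
    and "relative_homology_group (int (card s) - 1) (geometric_realization K) (polyhedron (K - {s})) \<cong> integer_group"
proof -
  let ?S = "{t. t \<subseteq> s \<and> t \<noteq> {}}"
  have fin: "finite s" "s \<noteq> {}" using K simplicial_complexD(1,2) by blast+
  have S: "simplicial_complex ?S" "?S \<subseteq> K" "s \<in> ?S"
    using fin finite_subset[OF _ fin(1)] simplicial_complexD(3)[OF K] by (auto simp: simplicial_complex_def)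
  have av: "avoiding K s = K - {s}" using max K by (auto simp: avoiding_def)
  have iso: "relative_homology_group p (geometric_realization ?S) (polyhedron (avoiding ?S s)) \<cong>
    relative_homology_group p (geometric_realization K) (polyhedron (K - {s}))" for p
    using excision_star_iso[OF K(1) S] max S(3) unfolding av by blast
  show "trivial_group (relative_homology_group p (geometric_realization K) (polyhedron (K - {s})))"
    if "p \<noteq> int (card s) - 1"
    using isomorphic_group_triviality1[OF iso] relative_homology_simplex_boundary(1)[OF fin that] by simp
  show "relative_homology_group (int (card s) - 1) (geometric_realization K) (polyhedron (K - {s})) \<cong> integer_group"
    using iso_trans[OF group.iso_sym[OF _ iso] relative_homology_simplex_boundary(2)[OF fin]] by simp
qed

lemma simplicial_complex_remove:
  assumes K: "simplicial_complex K" and max: "\<And>t. t \<in> K \<Longrightarrow> s \<subseteq> t \<Longrightarrow> t = s"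
  shows "simplicial_complex (K - {s})"
  unfolding simplicial_complex_def
proof (intro conjI ballI allI impI)
  fix t assume t: "t \<in> K - {s}"
  then show "finite t" "t \<noteq> {}" using simplicial_complexD(1,2)[OF K] by auto
  fix u assume u: "u \<subseteq> t \<and> u \<noteq> {}"
  then have "u \<in> K" using t simplicial_complexD(3)[OF K] by auto
  moreover have "u \<noteq> s" using max[of t] t u by auto
  ultimately show "u \<in> K - {s}" by simp
qed

lemma ex_max_card:
  assumes "finite A" "A \<noteq> {}" obtains s where "s \<in> A" "\<And>t. t \<in> A \<Longrightarrow> card t \<le> card s"
proof -
  have "Max (card ` A) \<in> card ` A" using assms by auto
  then obtain s where "s \<in> A" "card s = Max (card ` A)" by auto
  then show thesis using assms by (intro that[of s]) auto
qed

text \<open>Induction on the number of simplices outside \<open>L\<close>: removing one of maximal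
  cardinality affects relative homology only in its own dimension, which is below
  \<open>p\<close>.\<close>

lemma relative_homology_above_dimension:
  assumes "finite K" "simplicial_complex K" "simplicial_complex L" "L \<subseteq> K"
    and "\<And>s. s \<in> K \<Longrightarrow> int (card s) \<le> p"
  shows "trivial_group (relative_homology_group p (geometric_realization K) (polyhedron L))"
  using assms
proof (induction "card (K - L)" arbitrary: K)
  case 0
  then have "K = L" by auto
  then show ?case using trivial_relative_homology_group_topspace[of p "geometric_realization L"] by simp
next
  case (Suc k)
  have "finite (K - L)" "K - L \<noteq> {}" using Suc by auto
  then obtain s where s: "s \<in> K - L" and card: "\<And>t. t \<in> K - L \<Longrightarrow> card t \<le> card s"
    using ex_max_card by blast
  \<comment> \<open>Since \<open>L\<close> contains the faces of its simplices, a simplex above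
    \<open>s\<close> lies outside \<open>L\<close>; maximal cardinality then makes it equal to
    \<open>s\<close>.\<close>
  have max: "t = s" if "t \<in> K" "s \<subseteq> t" for t
  proof -
    have "t \<notin> L" using s that simplicial_complexD(2)[of K s] Suc.prems simplicial_complexD(3)[of L t s] by auto
    then have "card t \<le> card s" using card that by simp
    then show ?thesis using that simplicial_complexD(1)[of K t] Suc.prems(2)
      by (metis card_subset_eq card_mono le_antisym)
  qed
  have rem: "simplicial_complex (K - {s})" by (rule simplicial_complex_remove[OF Suc.prems(2) max])
  have "trivial_group (relative_homology_group p (geometric_realization (K - {s})) (polyhedron L))"
  proof (rule Suc.hyps(1))
    have "K - {s} - L = K - L - {s}" by auto
    then show "k = card (K - {s} - L)" using Suc.hyps(2) s by simp
  qed (use Suc.prems s rem in auto)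
  moreover have "trivial_group (relative_homology_group p (geometric_realization K) (polyhedron (K - {s})))"
  proof (rule relative_homology_add_simplex(1)[OF Suc.prems(2) _ max])
    show "s \<in> K" using s by simp
    then show "p \<noteq> int (card s) - 1" using Suc.prems(5)[of s] by simp
  qed
  ultimately show ?case
    using relative_homology_trans_trivial[of "polyhedron L" "polyhedron (K - {s})" p "geometric_realization K"]
      subtopology_subcomplex[of "K - {s}" K] polyhedron_mono[of L "K - {s}"] Suc.prems(4) s
    by (simp add: subset_Diff_insert)
qed

text \<open>After removal of a largest simplex the degree \<open>p\<close> homology injects, because
  the relative group in degree \<open>p + 1\<close> vanishes by dimension. The relative group in
  degree \<open>p\<close> is trivial or infinite cyclic, so freeness extends.\<close>

lemma homology_top_dimension_free:
  assumes "finite K" "simplicial_complex K" "\<And>s. s \<in> K \<Longrightarrow> int (card s) \<le> p + 1"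
  shows "finite_rank_free (homology_group p (geometric_realization K))"
  using assms
proof (induction "card K" arbitrary: K)
  case 0
  then have "K = {}" by auto
  then show ?case
    by (intro finite_rank_free_trivial trivial_homology_group_empty) simp
next
  case (Suc k)
  have "K \<noteq> {}" using Suc by auto
  then obtain s where s: "s \<in> K" and card: "\<And>t. t \<in> K \<Longrightarrow> card t \<le> card s"
    using ex_max_card Suc.prems(1) by blast
  have max: "t = s" if "t \<in> K" "s \<subseteq> t" for t
    using that card[of t] simplicial_complexD(1)[of K t] Suc.prems(2)
    by (metis card_subset_eq card_mono le_antisym)
  have rem: "simplicial_complex (K - {s})" by (rule simplicial_complex_remove[OF Suc.prems(2) max])
  let ?X = "geometric_realization K" and ?L = "polyhedron (K - {s})"
  have sub: "subtopology ?X ?L = geometric_realization (K - {s})" by (rule subtopology_subcomplex) auto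
  have free: "finite_rank_free (homology_group p (subtopology ?X ?L))"
    unfolding sub by (rule Suc.hyps(1)) (use Suc.hyps Suc.prems s rem in auto)
  have add1: "trivial_group (relative_homology_group q ?X ?L)" if "q \<noteq> int (card s) - 1" for q
    by (rule relative_homology_add_simplex(1)[OF Suc.prems(2) s max that])
  have add2: "relative_homology_group (int (card s) - 1) ?X ?L \<cong> integer_group"
    by (rule relative_homology_add_simplex(2)[OF Suc.prems(2) s max])
  have C: "trivial_group (relative_homology_group p ?X ?L) \<or> relative_homology_group p ?X ?L \<cong> integer_group"
    using add1[of p] add2 by (cases "p = int (card s) - 1") auto
  have "trivial_group (relative_homology_group (p + 1) ?X ?L)"
    using add1[of "p + 1"] Suc.prems(3)[OF s] by simp
  then have "inj_on (hom_induced p (subtopology ?X ?L) {} ?X {} id) (carrier (homology_group p (subtopology ?X ?L)))"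
    using exact_seq_trivial_imp_inj[OF homology_exactness_axiom_2[of "p + 1" ?X ?L]] by simp
  from finite_rank_free_extension[OF homology_exactness_axiom_3 this free C]
  show ?case by simp
qed

section \<open>Graded posets\<close>

lemma mem_ChainsI: "(\<And>a b. a \<in> C \<Longrightarrow> b \<in> C \<Longrightarrow> (a, b) \<in> leq \<or> (b, a) \<in> leq) \<Longrightarrow> C \<in> Chains leq"
  by (simp add: Chains_def)

lemma ChainsD1: "C \<in> Chains leq \<Longrightarrow> a \<in> C \<Longrightarrow> b \<in> C \<Longrightarrow> (a, b) \<in> leq \<or> (b, a) \<in> leq"
  by (simp add: Chains_def)

lemma Chains_subset: "C \<in> Chains leq \<Longrightarrow> D \<subseteq> C \<Longrightarrow> D \<in> Chains leq"
  by (auto simp: Chains_def)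

lemma Chains_insert:
  assumes "C \<in> Chains leq" "(z, z) \<in> leq" "\<And>c. c \<in> C \<Longrightarrow> (z, c) \<in> leq \<or> (c, z) \<in> leq"
  shows "insert z C \<in> Chains leq"
  using assms by (auto simp: Chains_def)

lemma finite_chain_greatest:
  assumes "trans leq" "finite S" "S \<noteq> {}" "S \<in> Chains leq"
  shows "\<exists>b\<in>S. \<forall>z\<in>S. (z, b) \<in> leq"
  using assms(2,3,4)
proof (induction S rule: finite_ne_induct)
  case (singleton x) then show ?case by (auto simp: Chains_def)
next
  case (insert x F)
  then obtain b where b: "b \<in> F" "\<forall>z\<in>F. (z, b) \<in> leq" using Chains_subset[of "insert x F" leq F] by blast
  have xx: "(x, x) \<in> leq" using ChainsD1[OF insert.prems, of x x] by simp
  have "(x, b) \<in> leq \<or> (b, x) \<in> leq" using ChainsD1[OF insert.prems, of x b] b by simp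
  then show ?case
  proof
    assume "(x, b) \<in> leq" then show ?thesis using b by (intro bexI[of _ b]) auto
  next
    assume bx: "(b, x) \<in> leq"
    have "(z, x) \<in> leq" if "z \<in> F" for z using transD[OF assms(1) _ bx] b(2) that by blast
    then show ?thesis using xx by (intro bexI[of _ x]) auto
  qed
qed

lemma finite_chain_least:
  assumes "trans leq" "finite S" "S \<noteq> {}" "S \<in> Chains leq"
  shows "\<exists>b\<in>S. \<forall>z\<in>S. (b, z) \<in> leq"
proof -
  have "S \<in> Chains (leq\<inverse>)" using assms(4) by (auto simp: Chains_def)
  then show ?thesis using finite_chain_greatest[of "leq\<inverse>" S] assms by auto
qed

lemma order_complex_iff: "C \<in> order_complex leq \<longleftrightarrow> C \<in> Chains leq \<and> finite C \<and> C \<noteq> {}"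
  by (auto simp: order_complex_def)

text \<open>Intervals, truncations and the complexes between consecutive truncations are all cut out
  of the order complex by such conditions \<open>Q\<close>.\<close>

lemma simplicial_complex_hereditary:
  assumes "\<And>C D. Q C \<Longrightarrow> D \<subseteq> C \<Longrightarrow> Q D"
  shows "simplicial_complex {C \<in> order_complex leq. Q C}"
  unfolding simplicial_complex_def
proof (intro conjI ballI allI impI)
  fix C assume C: "C \<in> {C \<in> order_complex leq. Q C}"
  then show "finite C" "C \<noteq> {}" by (auto simp: order_complex_iff)
  fix D assume D: "D \<subseteq> C \<and> D \<noteq> {}"
  then have "D \<in> Chains leq" "finite D" "Q D"
    using C Chains_subset[of C leq D] finite_subset[of D C] assms[of C D] by (auto simp: order_complex_iff)
  then show "D \<in> {C \<in> order_complex leq. Q C}" using D by (simp add: order_complex_iff)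
qed

lemma simplicial_complex_order_complex: "simplicial_complex (order_complex leq)"
  using simplicial_complex_hereditary[of "\<lambda>_. True" leq] by simp

definition interval_complex :: "'a rel \<Rightarrow> 'a \<Rightarrow> 'a \<Rightarrow> 'a set set" where
  "interval_complex leq x y = {C \<in> order_complex leq. \<forall>c\<in>C. (x, c) \<in> leq \<and> (c, y) \<in> leq}"

lemma simplicial_complex_interval: "simplicial_complex (interval_complex leq x y)"
  unfolding interval_complex_def by (rule simplicial_complex_hereditary) blast

section \<open>Ranks along maximal chains\<close>

locale graded_poset =
  fixes P :: "'a set" and leq :: "'a rel" and m :: nat and r :: "'a \<Rightarrow> nat"
  assumes graded: "finite_graded_poset P leq m" and rank: "is_rank_function P leq r"
begin

lemma finite_P: "finite P" and order: "refl_on P leq" "trans leq" "antisym leq" "leq \<subseteq> P \<times> P"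
  using graded partial_order_onD[of P leq] by (auto simp: finite_graded_poset_def)

lemma leq_trans: "(a, b) \<in> leq \<Longrightarrow> (b, c) \<in> leq \<Longrightarrow> (a, c) \<in> leq"
  using order(2) by (rule transD)

lemma leq_antisym: "(a, b) \<in> leq \<Longrightarrow> (b, a) \<in> leq \<Longrightarrow> a = b"
  using order(3) by (rule antisymD)

lemma leq_refl: "a \<in> P \<Longrightarrow> (a, a) \<in> leq"
  using order(1) by (rule refl_onD)

lemma leq_mem: "(a, b) \<in> leq \<Longrightarrow> a \<in> P" "(a, b) \<in> leq \<Longrightarrow> b \<in> P"
  using order(4) by auto

lemma chain_mem: "C \<in> Chains leq \<Longrightarrow> c \<in> C \<Longrightarrow> c \<in> P"
  using ChainsD1[of C leq c c] leq_mem by blast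

lemma chain_finite: "C \<in> Chains leq \<Longrightarrow> finite C"
  using finite_subset[OF _ finite_P] chain_mem by blast

lemma finite_order_complex: "finite (order_complex leq)"
proof (rule finite_subset)
  show "order_complex leq \<subseteq> Pow P" using chain_mem by (auto simp: order_complex_iff)
qed (simp add: finite_P)

lemma ex_maximal_chain:
  assumes "C \<in> Chains leq" obtains D where "maximal_chain leq D" "C \<subseteq> D"
proof -
  let ?A = "{D \<in> Chains leq. C \<subseteq> D}"
  have "?A \<subseteq> Pow P" using chain_mem by auto
  then have "finite ?A" "?A \<noteq> {}" using finite_subset finite_P assms by auto
  from ex_max_card[OF this] obtain D where D: "D \<in> ?A" "\<And>E. E \<in> ?A \<Longrightarrow> card E \<le> card D" by blast
  have "E = D" if E: "E \<in> Chains leq" "D \<subseteq> E" for E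
  proof -
    have "card E \<le> card D" using D E by auto
    then show ?thesis using card_seteq[OF chain_finite[OF E(1)] E(2)] by simp
  qed
  then have "maximal_chain leq D" using D(1) unfolding maximal_chain_def by simp
  then show thesis by (rule that) (use D(1) in blast)
qed

lemma maximal_chainD:
  assumes "maximal_chain leq C"
  shows "C \<in> Chains leq" "finite C" "card C = m + 1"
    and "\<And>z. z \<in> P \<Longrightarrow> (\<And>c. c \<in> C \<Longrightarrow> (z, c) \<in> leq \<or> (c, z) \<in> leq) \<Longrightarrow> z \<in> C"
proof -
  show C: "C \<in> Chains leq" using assms by (simp add: maximal_chain_def)
  then show "finite C" by (rule chain_finite)
  show "card C = m + 1" using graded assms by (simp add: finite_graded_poset_def)
  fix z assume "z \<in> P" "\<And>c. c \<in> C \<Longrightarrow> (z, c) \<in> leq \<or> (c, z) \<in> leq"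
  then have "insert z C \<in> Chains leq" using C leq_refl by (intro Chains_insert) auto
  then have "insert z C = C" using assms unfolding maximal_chain_def by blast
  then show "z \<in> C" by auto
qed

text \<open>Induction along the chain: its least element is minimal in \<open>P\<close>, and each
  further element covers its predecessor, since maximality leaves no room for an insertion.\<close>

lemma rank_eq_card_below:
  assumes C: "maximal_chain leq C" and "c \<in> C"
  shows "r c = card {z \<in> C. z \<noteq> c \<and> (z, c) \<in> leq}"
  using assms(2)
proof (induction "card {z \<in> C. z \<noteq> c \<and> (z, c) \<in> leq}" arbitrary: c rule: less_induct)
  case less
  note CC = maximal_chainD[OF C]
  let ?S = "{z \<in> C. z \<noteq> c \<and> (z, c) \<in> leq}"
  have above: "(c, w) \<in> leq" if "w \<in> C" "w \<notin> ?S" for w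
    using ChainsD1[OF CC(1) that(1) less.prems] that ChainsD1[OF CC(1) less.prems less.prems] by auto
  have cP: "c \<in> P" using CC(1) less.prems chain_mem by blast
  show ?case
  proof (cases "?S = {}")
    case True
    have "y = c" if y: "y \<in> P" "(y, c) \<in> leq" for y
    proof -
      have "(y, w) \<in> leq" if "w \<in> C" for w using leq_trans[OF y(2) above[OF that]] True by blast
      then have "y \<in> C" using CC(4)[OF y(1)] by blast
      then show ?thesis using y True by auto
    qed
    then have "minimal_element P leq c" using cP by (auto simp: minimal_element_def)
    then have "r c = 0" using rank by (auto simp: is_rank_function_def)
    then show ?thesis by (simp only: True card.empty)
  next
    case False
    have "?S \<in> Chains leq" using CC(1) by (rule Chains_subset) auto
    \<comment> \<open>\<open>b\<close> is the immediate predecessor of \<open>c\<close> in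
      \<open>C\<close>.\<close>
    then obtain b where b: "b \<in> ?S" "\<forall>z\<in>?S. (z, b) \<in> leq"
      using finite_chain_greatest[OF order(2) _ False] CC(2) by auto
    have "covers P leq c b"
      unfolding covers_def
    proof (intro conjI ballI impI)
      show "b \<in> P" "c \<in> P" "b \<noteq> c" "(b, c) \<in> leq" using b cP leq_mem(1)[of b c] by auto
      fix z assume z: "z \<in> P" "(b, z) \<in> leq \<and> (z, c) \<in> leq"
      have "(z, w) \<in> leq \<or> (w, z) \<in> leq" if w: "w \<in> C" for w
      proof (cases "w \<in> ?S")
        case True then show ?thesis using b z leq_trans[of w b z] by blast
      next
        case False then show ?thesis using above[OF w] z leq_trans[of z c w] by blast
      qed
      then have "z \<in> C" using CC(4)[OF z(1)] by blast
      then show "z = b \<or> z = c" using b z leq_antisym[of z b] by auto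
    qed
    then have rc: "r c = r b + 1" using rank by (auto simp: is_rank_function_def)
    have eq: "{z \<in> C. z \<noteq> b \<and> (z, b) \<in> leq} = ?S - {b}"
    proof (intro equalityI subsetI)
      fix z assume z: "z \<in> {z \<in> C. z \<noteq> b \<and> (z, b) \<in> leq}"
      then have "(z, c) \<in> leq" "z \<noteq> c" using b leq_trans[of z b c] leq_antisym[of b c] by auto
      then show "z \<in> ?S - {b}" using z by auto
    qed (use b in auto)
    have fin: "finite ?S" using CC(2) by simp
    have card: "card ?S = card (?S - {b}) + 1" using card_Suc_Diff1[OF fin b(1)] by simp
    have "r b = card {z \<in> C. z \<noteq> b \<and> (z, b) \<in> leq}"
    proof (rule less.hyps)
      show "card {z \<in> C. z \<noteq> b \<and> (z, b) \<in> leq} < card ?S" using card unfolding eq by linarith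
      show "b \<in> C" using b(1) by simp
    qed
    then show ?thesis using rc card unfolding eq by linarith
  qed
qed

text \<open>Both elements lie on one maximal chain, where the rank counts the elements
  below.\<close>

lemma rank_strict_mono:
  assumes "(a, b) \<in> leq" "a \<noteq> b" shows "r a < r b"
proof -
  have "{a, b} \<in> Chains leq" using assms leq_mem leq_refl by (auto simp: Chains_def)
  then obtain C where C: "maximal_chain leq C" "{a, b} \<subseteq> C" by (rule ex_maximal_chain)
  have "{z \<in> C. z \<noteq> a \<and> (z, a) \<in> leq} \<subset> {z \<in> C. z \<noteq> b \<and> (z, b) \<in> leq}"
  proof
    show "{z \<in> C. z \<noteq> a \<and> (z, a) \<in> leq} \<subseteq> {z \<in> C. z \<noteq> b \<and> (z, b) \<in> leq}"
      using leq_trans[OF _ assms(1)] leq_antisym[OF assms(1)] by blast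
    show "{z \<in> C. z \<noteq> a \<and> (z, a) \<in> leq} \<noteq> {z \<in> C. z \<noteq> b \<and> (z, b) \<in> leq}"
      using assms C(2) by blast
  qed
  then have "card {z \<in> C. z \<noteq> a \<and> (z, a) \<in> leq} < card {z \<in> C. z \<noteq> b \<and> (z, b) \<in> leq}"
    using maximal_chainD(2)[OF C(1)] by (intro psubset_card_mono) auto
  then show ?thesis using rank_eq_card_below[OF C(1)] C(2) by simp
qed

lemma rank_mono: "(a, b) \<in> leq \<Longrightarrow> r a \<le> r b"
  using rank_strict_mono[of a b] by (cases "a = b") auto

lemma rank_le: assumes "a \<in> P" shows "r a \<le> m"
proof -
  have "{a} \<in> Chains leq" using assms leq_refl by (auto simp: Chains_def)
  then obtain C where C: "maximal_chain leq C" "{a} \<subseteq> C" by (rule ex_maximal_chain)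
  note CC = maximal_chainD[OF C(1)]
  have "r a = card {z \<in> C. z \<noteq> a \<and> (z, a) \<in> leq}" using rank_eq_card_below[OF C(1)] C(2) by simp
  also have "\<dots> \<le> card (C - {a})" using CC(2) by (intro card_mono) auto
  also have "\<dots> = m" using CC(2,3) C(2) by simp
  finally show ?thesis .
qed

lemma rank_inj_on_chain:
  assumes "C \<in> Chains leq" shows "inj_on r C"
proof (rule inj_onI)
  fix a b assume "a \<in> C" "b \<in> C" "r a = r b"
  then show "a = b" using ChainsD1[OF assms, of a b] rank_strict_mono[of a b] rank_strict_mono[of b a] by auto
qed

text \<open>The \<open>m + 1\<close> elements have distinct ranks, all at most \<open>m\<close>, so
  every value is attained.\<close>

lemma maximal_chain_rank_image:
  assumes C: "maximal_chain leq C" shows "r ` C = {..m}"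
proof (rule card_subset_eq)
  note CC = maximal_chainD[OF C]
  show "r ` C \<subseteq> {..m}" using rank_le chain_mem[OF CC(1)] by auto
  show "card (r ` C) = card {..m}" using card_image[OF rank_inj_on_chain[OF CC(1)]] CC(3) by simp
qed simp

section \<open>Rank truncations of the order complex\<close>

abbreviation truncation :: "nat \<Rightarrow> 'a set set" where
  "truncation k \<equiv> rank_truncated_complex leq r k"

text \<open>The bottom and the top of a chain realize the largest rank difference. Bounding all
  differences instead makes closure under faces evident.\<close>

lemma truncation_eq: "truncation k = {C \<in> order_complex leq. \<forall>a\<in>C. \<forall>b\<in>C. r b \<le> r a + k}"
proof (intro equalityI subsetI)
  fix C assume "C \<in> truncation k"
  then obtain x y where C: "C \<in> order_complex leq" "x \<in> C" "y \<in> C" "r y \<le> r x + k"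
    and xy: "\<And>z. z \<in> C \<Longrightarrow> (x, z) \<in> leq" "\<And>z. z \<in> C \<Longrightarrow> (z, y) \<in> leq"
    by (auto simp: rank_truncated_complex_def)
  have "r b \<le> r a + k" if "a \<in> C" "b \<in> C" for a b
    using rank_mono[OF xy(1)[OF that(1)]] rank_mono[OF xy(2)[OF that(2)]] C(4) by linarith
  then show "C \<in> {C \<in> order_complex leq. \<forall>a\<in>C. \<forall>b\<in>C. r b \<le> r a + k}" using C by simp
next
  fix C assume C: "C \<in> {C \<in> order_complex leq. \<forall>a\<in>C. \<forall>b\<in>C. r b \<le> r a + k}"
  then have "finite C" "C \<noteq> {}" "C \<in> Chains leq" by (auto simp: order_complex_iff)
  then obtain x y where "x \<in> C" "y \<in> C" "\<forall>z\<in>C. (x, z) \<in> leq" "\<forall>z\<in>C. (z, y) \<in> leq"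
    using finite_chain_least[OF order(2)] finite_chain_greatest[OF order(2)] by metis
  then show "C \<in> truncation k" using C unfolding rank_truncated_complex_def by blast
qed

lemma simplicial_complex_truncation: "simplicial_complex (truncation k)"
  unfolding truncation_eq by (rule simplicial_complex_hereditary) blast

lemma truncation_top: "truncation m = order_complex leq"
proof -
  have "r b \<le> r a + m" if "C \<in> order_complex leq" "b \<in> C" for C a b
    using rank_le[of b] chain_mem[of C b] that by (simp add: order_complex_iff)
  then show ?thesis unfolding truncation_eq by auto
qed

lemma truncation_subset: "truncation k \<subseteq> order_complex leq"
  by (auto simp: rank_truncated_complex_def)

text \<open>Ranks are injective on a chain and confined to \<open>k + 1\<close> consecutive values,
  so the truncation has dimension at most \<open>k\<close>.\<close>

lemma card_truncation:
  assumes "C \<in> truncation k" shows "card C \<le> k + 1"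
proof -
  have C: "C \<in> Chains leq" "C \<noteq> {}" "\<And>a b. a \<in> C \<Longrightarrow> b \<in> C \<Longrightarrow> r b \<le> r a + k" "finite C"
    using assms by (auto simp: truncation_eq order_complex_iff)
  obtain a where a: "a \<in> C" "\<forall>z\<in>C. (a, z) \<in> leq"
    using finite_chain_least[OF order(2) C(4) C(2) C(1)] by blast
  have "r ` C \<subseteq> {r a..r a + k}" using a C(3) rank_mono by auto
  then have "card (r ` C) \<le> card {r a..r a + k}" by (intro card_mono) auto
  then show ?thesis using card_image[OF rank_inj_on_chain[OF C(1)]] by simp
qed

text \<open>The star of the simplex consisting of a maximal chain of \<open>{.. x}\<close> and a maximal chain of
  \<open>{y ..}\<close> in the order complex is a join over the star of \<open>{x, y}\<close> in the complex of the
  interval.\<close>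

lemma interval_local_homology:
  assumes xy: "(x, y) \<in> leq"
  obtains s where "s \<in> order_complex leq"
    and "\<And>p. relative_homology_group p (geometric_realization (interval_complex leq x y))
        (polyhedron (avoiding (interval_complex leq x y) {x, y})) \<cong>
      relative_homology_group (p + int m - (int (r y) - int (r x))) (geometric_realization (order_complex leq))
        (polyhedron (avoiding (order_complex leq) s))"
proof -
  let ?I = "interval_complex leq x y" and ?K = "order_complex leq"
  have xyc: "{x, y} \<in> Chains leq" using xy leq_mem leq_refl by (auto simp: Chains_def)
  then obtain C where C: "maximal_chain leq C" "{x, y} \<subseteq> C" by (rule ex_maximal_chain)
  note CC = maximal_chainD[OF C(1)]
  have xC: "x \<in> C" "y \<in> C" using C(2) by auto
  \<comment> \<open>\<open>D\<close> is the part of \<open>C\<close> outside the interval, strictly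
    below \<open>x\<close> or strictly above \<open>y\<close>. Together with \<open>x\<close> and
    \<open>y\<close> it forms the simplex \<open>s\<close>.\<close>
  define D1 where "D1 = {c \<in> C. c \<noteq> x \<and> (c, x) \<in> leq}"
  define D2 where "D2 = {c \<in> C. c \<noteq> y \<and> (y, c) \<in> leq}"
  define D where "D = D1 \<union> D2"
  have finD: "finite D1" "finite D2" "finite D" "D \<subseteq> C" using CC(2) by (auto simp: D1_def D2_def D_def)
  have "D1 \<inter> D2 = {}"
    using leq_trans[of y _ x] leq_antisym[OF xy] leq_antisym[of x] by (auto simp: D1_def D2_def)
  then have "card D = card D1 + card D2" unfolding D_def using finD by (intro card_Un_disjoint)
  moreover have "card D1 = r x" using rank_eq_card_below[OF C(1) xC(1)] by (simp add: D1_def)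
  moreover have "card D2 + r y = m"
  proof -
    have "D2 = C - {y} - {z \<in> C. z \<noteq> y \<and> (z, y) \<in> leq}"
      using ChainsD1[OF CC(1) xC(2)] leq_antisym by (auto simp: D2_def)
    moreover have "card (C - {y}) = m" using CC(2,3) xC by simp
    moreover have sub: "{z \<in> C. z \<noteq> y \<and> (z, y) \<in> leq} \<subseteq> C - {y}" by auto
    ultimately have "card D2 = m - r y"
      using rank_eq_card_below[OF C(1) xC(2)] CC(2) by (simp add: card_Diff_subset)
    then show ?thesis using rank_le[of y] leq_mem(2)[OF xy] by simp
  qed
  \<comment> \<open>Each vertex of \<open>D\<close> shifts the degree by one; this is the source of
    the offset in the conclusion.\<close>
  ultimately have cardD: "int (card D) = int m - (int (r y) - int (r x))" by linarith
  have notin: "\<not> ((x, c) \<in> leq \<and> (c, y) \<in> leq)" if "c \<in> D" for c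
    using that leq_antisym[of c x] leq_antisym[of c y] leq_trans xy by (auto simp: D_def D1_def D2_def)
  have disj: "D \<inter> \<Union>?I = {}"
    using notin by (auto simp: interval_complex_def)
  have xyI: "{x, y} \<in> ?I"
    using xyc xy leq_refl leq_mem[OF xy] by (auto simp: interval_complex_def order_complex_iff)
  let ?J = "join_simplex ?I D" and ?s = "{x, y} \<union> D"
  have J: "simplicial_complex ?J" "?s \<in> ?J"
    and iso: "\<And>p. relative_homology_group p (geometric_realization ?I) (polyhedron (avoiding ?I {x, y})) \<cong>
    relative_homology_group (p + int (card D)) (geometric_realization ?J) (polyhedron (avoiding ?J ?s))"
    using relative_homology_join_iso[OF finD(3) simplicial_complex_interval xyI disj] by auto
  \<comment> \<open>Elements of \<open>D\<close> are comparable with the whole interval, so a chain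
    of the interval joined with any part of \<open>D\<close> is again a chain.\<close>
  have comp: "(a, b) \<in> leq \<or> (b, a) \<in> leq" if "a \<in> D" "(x, b) \<in> leq" "(b, y) \<in> leq" for a b
    using that leq_trans[of a x b] leq_trans[of b y a] by (auto simp: D_def D1_def D2_def)
  have JK: "?J \<subseteq> ?K"
  proof
    fix t assume t: "t \<in> ?J"
    have tI: "t - D \<in> insert {} ?I" "t \<noteq> {}" using t by (auto simp: join_simplex_def)
    have "u \<in> Chains leq \<and> finite u \<and> (\<forall>c\<in>u. (x, c) \<in> leq \<and> (c, y) \<in> leq)" if "u \<in> insert {} ?I" for u
      using that by (auto simp: interval_complex_def order_complex_iff Chains_def)
    from this[OF tI(1)] have chain: "t - D \<in> Chains leq" and fin: "finite (t - D)"
      and bd: "\<And>c. c \<in> t - D \<Longrightarrow> (x, c) \<in> leq \<and> (c, y) \<in> leq"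
      by blast+
    have "t \<in> Chains leq"
    proof (rule mem_ChainsI)
      fix a b assume ab: "a \<in> t" "b \<in> t"
      consider "a \<in> D" "b \<in> D" | "a \<in> D" "b \<in> t - D" | "a \<in> t - D" "b \<in> D" | "a \<in> t - D" "b \<in> t - D"
        using ab by blast
      then show "(a, b) \<in> leq \<or> (b, a) \<in> leq"
      proof cases
        case 1 then show ?thesis using finD(4) ChainsD1[OF CC(1)] by blast
      next
        case 2 then show ?thesis using comp[of a b] bd[of b] by blast
      next
        case 3 then show ?thesis using comp[of b a] bd[of a] by blast
      next
        case 4 then show ?thesis using ChainsD1[OF chain] by blast
      qed
    qed
    moreover have "finite t" using fin finD(3) by (simp add: finite_Diff2)
    ultimately show "t \<in> ?K" using tI by (simp add: order_complex_iff)
  qed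
  \<comment> \<open>In a chain through \<open>?s\<close>, all elements outside \<open>D\<close> lie
    in the interval: one strictly below \<open>x\<close> would be comparable with all of
    \<open>C\<close>, hence in \<open>C\<close> by maximality and thus in \<open>D\<close>; dually
    above \<open>y\<close>.\<close>
  have star: "t \<in> ?J" if t: "t \<in> ?K" "?s \<subseteq> t" for t
  proof -
    have tc: "t \<in> Chains leq" "finite t" "t \<noteq> {}" using t by (auto simp: order_complex_iff)
    have xt: "x \<in> t" "y \<in> t" "D \<subseteq> t" using t by auto
    have "(x, c) \<in> leq \<and> (c, y) \<in> leq" if c: "c \<in> t - D" for c
    proof -
      have ct: "c \<in> t" "c \<notin> D" using c by auto
      have cP: "c \<in> P" using chain_mem[OF tc(1) ct(1)] .
      have cD: "(c, d) \<in> leq \<or> (d, c) \<in> leq" if "d \<in> D" for d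
        using ChainsD1[OF tc(1) ct(1)] xt that by blast
      have "(x, c) \<in> leq"
      proof (rule ccontr)
        assume n: "(x, c) \<notin> leq"
        then have cx: "(c, x) \<in> leq" using ChainsD1[OF tc(1) ct(1) xt(1)] by simp
        have "(c, w) \<in> leq \<or> (w, c) \<in> leq" if w: "w \<in> C" for w
        proof (cases "w \<in> D")
          case False
          then have "(x, w) \<in> leq"
            using ChainsD1[OF CC(1) w xC(1)] w leq_refl[of x] leq_mem(1)[OF xy] by (auto simp: D_def D1_def)
          then show ?thesis using leq_trans[OF cx] by blast
        qed (use cD in blast)
        then have "c \<in> C" using CC(4)[OF cP] by blast
        then have "c = x" using ct cx by (auto simp: D_def D1_def)
        then show False using n cx by simp
      qed
      moreover have "(c, y) \<in> leq"
      proof (rule ccontr)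
        assume n: "(c, y) \<notin> leq"
        then have cx: "(y, c) \<in> leq" using ChainsD1[OF tc(1) ct(1) xt(2)] by simp
        have "(c, w) \<in> leq \<or> (w, c) \<in> leq" if w: "w \<in> C" for w
        proof (cases "w \<in> D")
          case False
          then have "(w, y) \<in> leq"
            using ChainsD1[OF CC(1) w xC(2)] w leq_refl[of y] leq_mem(2)[OF xy] by (auto simp: D_def D2_def)
          then show ?thesis using leq_trans[OF _ cx] by blast
        qed (use cD in blast)
        then have "c \<in> C" using CC(4)[OF cP] by blast
        then have "c = y" using ct cx by (auto simp: D_def D2_def)
        then show False using n cx by simp
      qed
      ultimately show ?thesis ..
    qed
    moreover have "t - D \<in> Chains leq" by (rule Chains_subset[OF tc(1)]) auto
    ultimately have "t - D \<in> insert {} ?I"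
      using tc(2) by (auto simp: interval_complex_def order_complex_iff)
    then show ?thesis using tc(3) by (simp add: join_simplex_def)
  qed
  show thesis
  proof (rule that)
    show "?s \<in> ?K" using J JK by blast
    fix p
    have "relative_homology_group (p + int (card D)) (geometric_realization ?J) (polyhedron (avoiding ?J ?s)) \<cong>
      relative_homology_group (p + int (card D)) (geometric_realization ?K) (polyhedron (avoiding ?K ?s))"
      by (rule excision_star_iso[OF simplicial_complex_order_complex J(1) JK J(2) star])
    from iso_trans[OF iso this]
    show "relative_homology_group p (geometric_realization ?I) (polyhedron (avoiding ?I {x, y})) \<cong>
      relative_homology_group (p + int m - (int (r y) - int (r x))) (geometric_realization ?K) (polyhedron (avoiding ?K ?s))"
      unfolding cardD by (simp add: algebra_simps)
  qed
qed

end

section \<open>Posets triangulating homology manifolds\<close>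

text \<open>The homeomorphism carries the barycenter of \<open>s\<close> to a point of
  \<open>X\<close>, where the manifold condition applies.\<close>

lemma local_homology_of_triangulation:
  assumes X: "homology_manifold n X" and tri: "triangulates K X"
    and K: "simplicial_complex K" and s: "s \<in> K"
  shows "p \<noteq> int n \<Longrightarrow> trivial_group (relative_homology_group p (geometric_realization K) (polyhedron (avoiding K s)))"
    and "relative_homology_group (int n) (geometric_realization K) (polyhedron (avoiding K s)) \<cong> integer_group"
proof -
  obtain f where f: "homeomorphic_map (geometric_realization K) X f"
    using tri homeomorphic_space by (auto simp: triangulates_def)
  let ?b = "barycenter s"
  have b: "?b \<in> polyhedron K" by (rule barycenter_in_polyhedron[OF K s])
  have im: "f ` polyhedron K = topspace X" and inj: "inj_on f (polyhedron K)"
    using homeomorphic_imp_surjective_map[OF f] homeomorphic_imp_injective_map[OF f] by simp_all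
  have "f ` (polyhedron K - {?b}) = topspace X - {f ?b}"
    using inj_on_image_set_diff[OF inj, of "polyhedron K" "{?b}"] b im by simp
  then have "relative_homology_group p (geometric_realization K) (polyhedron K - {?b}) \<cong>
      relative_homology_group p X (topspace X - {f ?b})" for p
    using homeomorphic_map_relative_homology_iso[OF f, of "polyhedron K - {?b}"] by (intro is_isoI) auto
  from iso_trans[OF relative_homology_avoiding_iso_local[OF K s] this]
  have iso: "relative_homology_group p (geometric_realization K) (polyhedron (avoiding K s)) \<cong>
      relative_homology_group p X (topspace X - {f ?b})" for p .
  have fb: "f ?b \<in> topspace X" using b im by blast
  show "trivial_group (relative_homology_group p (geometric_realization K) (polyhedron (avoiding K s)))"
    if "p \<noteq> int n"
    using isomorphic_group_triviality[OF iso] X fb that by (simp add: homology_manifold_def)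
  show "relative_homology_group (int n) (geometric_realization K) (polyhedron (avoiding K s)) \<cong> integer_group"
  proof (rule iso_trans[OF iso])
    show "relative_homology_group (int n) X (topspace X - {f ?b}) \<cong> integer_group"
      using X fb by (simp add: homology_manifold_def)
  qed
qed

lemma nontrivial_if_iso_integer:
  assumes "G \<cong> integer_group" shows "\<not> trivial_group G"
proof
  assume "trivial_group G"
  then have "trivial_group integer_group" using isomorphic_group_triviality1[OF assms] by simp
  then have "(UNIV :: int set) = {0}" by (simp add: trivial_group_def)
  then show False by (metis UNIV_I singletonD zero_neq_one)
qed

locale manifold_poset = graded_poset P leq m r
  for P :: "'a set" and leq m r +
  fixes n :: nat and X :: "'b topology"
  assumes manifold: "homology_manifold n X" and triangulation: "triangulates (order_complex leq) X"
begin

lemma ex_max_chain: obtains C where "maximal_chain leq C"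
  using ex_maximal_chain[of "{}"] by (auto simp: Chains_def)

text \<open>The interval from \<open>x\<close> to \<open>x\<close> is a point. Its homology in
  degree 0 reappears in degree \<open>m\<close> of a local homology of the manifold, which is
  nonzero only in degree \<open>n\<close>.\<close>

lemma rank_eq_dimension: "m = n"
proof -
  obtain C where C: "maximal_chain leq C" by (rule ex_max_chain)
  then have "C \<noteq> {}" using maximal_chainD(3)[OF C] by auto
  then obtain x where "x \<in> C" by auto
  then have x: "x \<in> P" using chain_mem[OF maximal_chainD(1)[OF C]] by blast
  obtain s where s: "s \<in> order_complex leq"
    and iso: "\<And>p. relative_homology_group p (geometric_realization (interval_complex leq x x))
        (polyhedron (avoiding (interval_complex leq x x) {x, x})) \<cong>
      relative_homology_group (p + int m - (int (r x) - int (r x))) (geometric_realization (order_complex leq))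
        (polyhedron (avoiding (order_complex leq) s))"
    using interval_local_homology[OF leq_refl[OF x]] by metis
  have I: "interval_complex leq x x = {{x}}"
  proof (intro equalityI subsetI)
    fix t assume t: "t \<in> interval_complex leq x x"
    then have "t \<noteq> {}" "\<forall>c\<in>t. c = x" by (auto simp: interval_complex_def order_complex_iff intro: leq_antisym)
    then show "t \<in> {{x}}" by auto
  qed (use leq_refl[OF x] in \<open>auto simp: interval_complex_def order_complex_iff Chains_def\<close>)
  have av: "avoiding {{x}} {x, x} = {}" by (auto simp: avoiding_def)
  have "homology_group 0 (geometric_realization {{x}}) \<cong> integer_group"
    by (rule homology_coefficients) (simp add: polyhedron_singleton)
  then have "\<not> trivial_group (homology_group 0 (geometric_realization {{x}}))"
    by (rule nontrivial_if_iso_integer)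
  then have "\<not> trivial_group (relative_homology_group (int m) (geometric_realization (order_complex leq))
        (polyhedron (avoiding (order_complex leq) s)))"
    using isomorphic_group_triviality[OF iso[of 0]] unfolding I av by simp
  then show ?thesis
    using local_homology_of_triangulation(1)[OF manifold triangulation simplicial_complex_order_complex s, of "int m"]
    by auto
qed

text \<open>The shift carries degree \<open>p\<close> to \<open>p + n - k\<close>, which is the
  manifold dimension exactly for \<open>p = k\<close>.\<close>

lemma interval_homology:
  assumes "(x, y) \<in> leq" and k: "r y = r x + k"
  shows "p \<noteq> int k \<Longrightarrow> trivial_group (relative_homology_group p (geometric_realization (interval_complex leq x y))
      (polyhedron (avoiding (interval_complex leq x y) {x, y})))"
    and "relative_homology_group (int k) (geometric_realization (interval_complex leq x y))
      (polyhedron (avoiding (interval_complex leq x y) {x, y})) \<cong> integer_group"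
proof -
  obtain s where s: "s \<in> order_complex leq"
    and iso: "\<And>p. relative_homology_group p (geometric_realization (interval_complex leq x y))
        (polyhedron (avoiding (interval_complex leq x y) {x, y})) \<cong>
      relative_homology_group (p + int m - (int (r y) - int (r x))) (geometric_realization (order_complex leq))
        (polyhedron (avoiding (order_complex leq) s))"
    using interval_local_homology[OF assms(1)] by metis
  note loc = local_homology_of_triangulation[OF manifold triangulation simplicial_complex_order_complex s]
  show "trivial_group (relative_homology_group p (geometric_realization (interval_complex leq x y))
      (polyhedron (avoiding (interval_complex leq x y) {x, y})))" if "p \<noteq> int k"
    using isomorphic_group_triviality[OF iso[of p]] loc(1)[of "p + int m - (int (r y) - int (r x))"] that k
      rank_eq_dimension by simp
  show "relative_homology_group (int k) (geometric_realization (interval_complex leq x y))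
      (polyhedron (avoiding (interval_complex leq x y) {x, y})) \<cong> integer_group"
    using iso_trans[OF iso[of "int k"]] loc(2) k rank_eq_dimension by simp
qed

text \<open>Interpolates between consecutive truncations: \<open>Q\<close> is the set of those pairs of elements at
  rank distance \<open>k + 1\<close> that may occur together in a simplex.\<close>

definition partial_truncation :: "nat \<Rightarrow> ('a \<times> 'a) set \<Rightarrow> 'a set set" where
  "partial_truncation k Q = {C \<in> order_complex leq.
     \<forall>a\<in>C. \<forall>b\<in>C. r b \<le> r a + k + 1 \<and> (r b = r a + k + 1 \<longrightarrow> (a, b) \<in> Q)}"

lemma simplicial_complex_partial_truncation: "simplicial_complex (partial_truncation k Q)"
  unfolding partial_truncation_def by (rule simplicial_complex_hereditary) blast

lemma partial_truncation_empty: "partial_truncation k {} = truncation k"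
proof -
  have "r b \<le> r a + k + 1 \<and> (r b = r a + k + 1 \<longrightarrow> (a, b) \<in> {}) \<longleftrightarrow> r b \<le> r a + k" for a b
    by auto
  then show ?thesis unfolding partial_truncation_def truncation_eq by simp
qed

text \<open>Elements of a chain are comparable, and the one of larger rank must be the upper
  one.\<close>

lemma partial_truncation_all:
  "partial_truncation k {(x, y) \<in> leq. r y = r x + k + 1} = truncation (k + 1)"
proof -
  have "(a, b) \<in> leq" if "C \<in> order_complex leq" "a \<in> C" "b \<in> C" "r b = r a + k + 1" for C a b
    using that ChainsD1[of C leq a b] rank_mono[of b a] by (auto simp: order_complex_iff)
  then show ?thesis unfolding partial_truncation_def truncation_eq by (auto simp: add.assoc)
qed

text \<open>By the rank bound every simplex containing \<open>x\<close> and \<open>y\<close> lies in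
  their interval, so by excision the step is governed by the interval alone.\<close>

lemma partial_truncation_step:
  assumes xy: "(x, y) \<in> leq" "r y = r x + k + 1" and Q: "(x, y) \<notin> Q" and p: "p \<noteq> int k + 1"
  shows "trivial_group (relative_homology_group p (geometric_realization (partial_truncation k (insert (x, y) Q)))
    (polyhedron (partial_truncation k Q)))"
proof -
  let ?M = "partial_truncation k (insert (x, y) Q)" and ?I = "interval_complex leq x y"
  \<comment> \<open>Of the simplices in \<open>?M\<close>, exactly those containing both
    \<open>x\<close> and \<open>y\<close> depend on the new pair.\<close>
  have av: "avoiding ?M {x, y} = partial_truncation k Q"
  proof (intro equalityI subsetI)
    fix C assume "C \<in> avoiding ?M {x, y}"
    then have C: "C \<in> ?M" "\<not> {x, y} \<subseteq> C" by (auto simp: avoiding_def)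
    have "(a, b) \<in> Q" if "a \<in> C" "b \<in> C" "r b = r a + k + 1" for a b
    proof -
      have "(a, b) \<in> insert (x, y) Q" using C(1) that by (simp add: partial_truncation_def)
      then show ?thesis using C(2) that by auto
    qed
    then show "C \<in> partial_truncation k Q" using C(1) by (simp add: partial_truncation_def)
  next
    fix C assume C: "C \<in> partial_truncation k Q"
    then have "\<not> {x, y} \<subseteq> C" using xy(2) Q by (auto simp: partial_truncation_def)
    then show "C \<in> avoiding ?M {x, y}" using C by (simp add: avoiding_def partial_truncation_def)
  qed
  have IM: "?I \<subseteq> ?M"
  proof
    fix C assume C: "C \<in> ?I"
    then have CC: "C \<in> order_complex leq" "\<And>c. c \<in> C \<Longrightarrow> (x, c) \<in> leq" "\<And>c. c \<in> C \<Longrightarrow> (c, y) \<in> leq"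
      by (auto simp: interval_complex_def)
    have "r b \<le> r a + k + 1 \<and> (r b = r a + k + 1 \<longrightarrow> (a, b) \<in> insert (x, y) Q)" if ab: "a \<in> C" "b \<in> C" for a b
    proof -
      have le: "r x \<le> r a" "r b \<le> r y" using rank_mono CC(2)[OF ab(1)] CC(3)[OF ab(2)] by auto
      \<comment> \<open>Rank distance \<open>k + 1\<close> inside the interval is reached only by
        its two ends, since rank is strictly monotone.\<close>
      have "(a, b) = (x, y)" if "r b = r a + k + 1"
      proof -
        have "r x = r a" "r b = r y" using le that xy(2) by linarith+
        then show ?thesis
          using rank_strict_mono[OF CC(2)[OF ab(1)]] rank_strict_mono[OF CC(3)[OF ab(2)]] by auto
      qed
      then show ?thesis using le xy(2) by auto
    qed
    then show "C \<in> ?M" using CC(1) unfolding partial_truncation_def by blast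
  qed
  have xyI: "{x, y} \<in> ?I"
    using xy(1) leq_refl leq_mem[OF xy(1)] by (auto simp: interval_complex_def order_complex_iff Chains_def)
  \<comment> \<open>An element strictly below \<open>x\<close> would differ from \<open>y\<close> in
    rank by more than \<open>k + 1\<close>; likewise one strictly above \<open>y\<close> from
    \<open>x\<close>.\<close>
  have star: "C \<in> ?I" if C: "C \<in> ?M" "{x, y} \<subseteq> C" for C
  proof -
    have CC: "C \<in> order_complex leq" "C \<in> Chains leq"
      and bd: "\<And>a b. a \<in> C \<Longrightarrow> b \<in> C \<Longrightarrow> r b \<le> r a + k + 1"
      using C(1) by (auto simp: partial_truncation_def order_complex_iff)
    have "(x, c) \<in> leq \<and> (c, y) \<in> leq" if c: "c \<in> C" for c
    proof
      show "(x, c) \<in> leq"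
        using ChainsD1[OF CC(2) c, of x] C(2) rank_strict_mono[of c x] bd[OF c, of y] xy(2)
          leq_refl[OF leq_mem(1)[OF xy(1)]] by (cases "c = x") auto
      show "(c, y) \<in> leq"
        using ChainsD1[OF CC(2) c, of y] C(2) rank_strict_mono[of y c] bd[OF _ c, of x] xy(2)
          leq_refl[OF leq_mem(2)[OF xy(1)]] by (cases "c = y") auto
    qed
    then show ?thesis using CC(1) by (simp add: interval_complex_def)
  qed
  have "relative_homology_group p (geometric_realization ?I) (polyhedron (avoiding ?I {x, y})) \<cong>
    relative_homology_group p (geometric_realization ?M) (polyhedron (avoiding ?M {x, y}))"
    by (rule excision_star_iso[OF simplicial_complex_partial_truncation simplicial_complex_interval IM xyI star])
  moreover have "trivial_group (relative_homology_group p (geometric_realization ?I) (polyhedron (avoiding ?I {x, y})))"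
    by (rule interval_homology(1)[OF xy(1), of "k + 1"]) (use xy(2) p in auto)
  ultimately show ?thesis
    using isomorphic_group_triviality1[OF _ group_relative_homology_group] unfolding av by blast
qed

lemma truncation_relative_homology_trivial:
  assumes p: "p \<noteq> int k + 1"
  shows "trivial_group (relative_homology_group p (geometric_realization (truncation (k + 1))) (polyhedron (truncation k)))"
proof -
  have "trivial_group (relative_homology_group p (geometric_realization (partial_truncation k Q)) (polyhedron (truncation k)))"
    if "finite Q" "Q \<subseteq> {(x, y) \<in> leq. r y = r x + k + 1}" for Q
    using that
  proof (induction Q rule: finite_induct)
    case empty
    show ?case
      using trivial_relative_homology_group_topspace[of p "geometric_realization (truncation k)"]
      by (simp add: partial_truncation_empty)
  next
    case (insert q Q)
    obtain x y where q: "q = (x, y)" by (cases q)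
    have sub: "partial_truncation k Q \<subseteq> partial_truncation k (insert q Q)" "truncation k \<subseteq> partial_truncation k Q"
      by (auto simp: partial_truncation_def partial_truncation_empty[symmetric])
    show ?case
    proof (rule relative_homology_trans_trivial)
      show "polyhedron (truncation k) \<subseteq> polyhedron (partial_truncation k Q)" by (rule polyhedron_mono[OF sub(2)])
      show "trivial_group (relative_homology_group p (subtopology (geometric_realization (partial_truncation k (insert q Q)))
          (polyhedron (partial_truncation k Q))) (polyhedron (truncation k)))"
        unfolding subtopology_subcomplex[OF sub(1)] using insert by blast
      show "trivial_group (relative_homology_group p (geometric_realization (partial_truncation k (insert q Q)))
          (polyhedron (partial_truncation k Q)))"
        unfolding q by (rule partial_truncation_step) (use insert q p in auto)
    qed
  qed
  moreover have "finite {(x, y) \<in> leq. r y = r x + k + 1}"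
    by (rule finite_subset[of _ "P \<times> P"]) (use order(4) finite_P in auto)
  ultimately show ?thesis using partial_truncation_all by force
qed

text \<open>For \<open>i \<le> k - 1\<close> neither \<open>i\<close> nor \<open>i + 1\<close> is
  the exceptional degree \<open>k + 1\<close>, so both neighbouring relative groups vanish.\<close>

lemma truncation_Suc_homology_iso:
  assumes "i \<le> int k - 1"
  shows "homology_group i (geometric_realization (truncation k)) \<cong>
    homology_group i (geometric_realization (truncation (Suc k)))"
proof -
  have sub: "truncation k \<subseteq> truncation (k + 1)"
  proof -
    have "r b \<le> r a + k \<Longrightarrow> r b \<le> r a + (k + 1)" for a b by simp
    then show ?thesis unfolding truncation_eq by blast
  qed
  have "homology_group i (subtopology (geometric_realization (truncation (k + 1))) (polyhedron (truncation k))) \<cong>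
    homology_group i (geometric_realization (truncation (k + 1)))"
    by (rule relative_homology_iso_subspace[where S = "polyhedron (truncation k)"])
      (use assms truncation_relative_homology_trivial in auto)
  then show ?thesis unfolding subtopology_subcomplex[OF sub] by simp
qed

text \<open>The isomorphisms from \<open>k\<close> up to \<open>n\<close> compose, and the last
  truncation is the full order complex because the rank of \<open>P\<close> equals
  \<open>n\<close>.\<close>

lemma truncation_homology_iso:
  assumes "k \<le> n" "i \<le> int k - 1"
  shows "homology_group i (geometric_realization (truncation k)) \<cong> homology_group i X"
proof -
  have "homology_group i (geometric_realization (truncation k)) \<cong> homology_group i (geometric_realization (truncation n))"
    using assms
  proof (induction k rule: inc_induct)
    case base show ?case by (rule iso_refl)
  next
    case (step l)
    then show ?case using iso_trans[OF truncation_Suc_homology_iso[of i l]] by simp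
  qed
  also have "truncation n = order_complex leq" using truncation_top rank_eq_dimension by simp
  also have "homology_group i (geometric_realization (order_complex leq)) \<cong> homology_group i X"
    using triangulation by (intro homeomorphic_space_imp_isomorphic_homology_groups) (simp add: triangulates_def)
  finally show ?thesis .
qed

text \<open>The truncation has dimension at most \<open>k\<close>, so the result on top-degree
  homology applies.\<close>

lemma truncation_homology_free: "free_abelian (homology_group (int k) (geometric_realization (truncation k)))"
proof (rule finite_rank_free_imp_free_abelian)
  show "finite_rank_free (homology_group (int k) (geometric_realization (truncation k)))"
  proof (rule homology_top_dimension_free[OF _ simplicial_complex_truncation])
    show "finite (truncation k)" using finite_subset[OF truncation_subset finite_order_complex] .
    show "int (card s) \<le> int k + 1" if "s \<in> truncation k" for s using card_truncation[OF that] by simp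
  qed
qed simp

text \<open>An interval of rank \<open>k + 1\<close> has contractible order complex, and deleting the simplices that
  contain both end points leaves a \<open>k\<close>-dimensional subcomplex of the truncation, with the homology
  of a sphere.\<close>

lemma truncation_homology_nontrivial:
  assumes "k < n"
  shows "\<not> trivial_group (homology_group (int k) (geometric_realization (truncation k)))"
proof
  let ?T = "truncation k"
  assume triv: "trivial_group (homology_group (int k) (geometric_realization ?T))"
  obtain C where C: "maximal_chain leq C" by (rule ex_max_chain)
  \<comment> \<open>A maximal chain meets every rank up to \<open>n\<close>; \<open>k < n\<close>
    provides the element of rank \<open>k + 1\<close>.\<close>
  have "0 \<in> r ` C" "k + 1 \<in> r ` C"
    using maximal_chain_rank_image[OF C] assms rank_eq_dimension by auto
  then obtain x y where xC: "x \<in> C" "y \<in> C" and rxy: "r x = 0" "r y = k + 1" by auto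
  have xy: "(x, y) \<in> leq"
    using ChainsD1[OF maximal_chainD(1)[OF C] xC] rank_mono[of y x] rxy by auto
  let ?I = "interval_complex leq x y"
  let ?L = "avoiding ?I {x, y}"
  have I: "simplicial_complex ?I" by (rule simplicial_complex_interval)
  have L: "simplicial_complex ?L" "?L \<subseteq> ?I"
    by (rule simplicial_complex_avoiding[OF I], rule avoiding_subset)
  \<comment> \<open>Every chain of the interval can be extended by \<open>x\<close>, so the complex
    is a cone.\<close>
  have "trivial_group (homology_group (int k + 1) (geometric_realization ?I))"
  proof (rule homology_cone_trivial[OF I])
    have xx: "(x, x) \<in> leq" using xy leq_refl leq_mem by blast
    then show "{x} \<in> ?I" using xy by (auto simp: interval_complex_def order_complex_iff Chains_def)
    fix s assume s: "s \<in> ?I"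
    then have "insert x s \<in> Chains leq"
      using xx by (intro Chains_insert) (auto simp: interval_complex_def order_complex_iff)
    then show "insert x s \<in> ?I" using s xx xy by (auto simp: interval_complex_def order_complex_iff)
  qed auto
  moreover have LT: "?L \<subseteq> ?T"
  proof
    fix s assume s: "s \<in> ?L"
    have sI: "s \<in> order_complex leq" "\<And>c. c \<in> s \<Longrightarrow> (x, c) \<in> leq" "\<And>c. c \<in> s \<Longrightarrow> (c, y) \<in> leq"
      and ns: "x \<notin> s \<or> y \<notin> s"
      using s by (auto simp: avoiding_def interval_complex_def)
    have "r b \<le> r a + k" if ab: "a \<in> s" "b \<in> s" for a b
    proof (cases "x = a")
      case True
      then have "b \<noteq> y" using ns ab by auto
      then show ?thesis using rank_strict_mono[OF sI(3)[OF ab(2)]] rxy by simp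
    next
      case False
      then show ?thesis
        using rank_strict_mono[OF sI(2)[OF ab(1)]] rank_mono[OF sI(3)[OF ab(2)]] rxy by simp
    qed
    then show "s \<in> ?T" using sI(1) by (simp add: truncation_eq)
  qed
  moreover have "trivial_group (homology_group (int k) (geometric_realization ?L))"
  proof -
    \<comment> \<open>By dimension this relative group vanishes, so the degree \<open>k\<close>
      homology of \<open>?L\<close> injects into that of the truncation, assumed trivial.\<close>
    have "trivial_group (relative_homology_group (int k + 1) (geometric_realization ?T) (polyhedron ?L))"
    proof (rule relative_homology_above_dimension[OF _ simplicial_complex_truncation L(1) LT])
      show "finite ?T" using finite_subset[OF truncation_subset finite_order_complex] .
      show "int (card s) \<le> int k + 1" if "s \<in> ?T" for s using card_truncation[OF that] by simp
    qed
    from relative_homology_subspace_trivial[OF _ this triv] show ?thesis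
      unfolding subtopology_subcomplex[OF LT] by simp
  qed
  \<comment> \<open>The relative group is caught between two trivial groups, yet by the interval
    homology it is infinite cyclic.\<close>
  ultimately have "trivial_group (relative_homology_group (int k + 1) (geometric_realization ?I) (polyhedron ?L))"
    using relative_homology_quotient_trivial[of "{}" "polyhedron ?L" "int k + 1" "geometric_realization ?I"]
    unfolding subtopology_subcomplex[OF L(2)] by simp
  moreover have "relative_homology_group (int (k + 1)) (geometric_realization ?I) (polyhedron ?L) \<cong> integer_group"
    by (rule interval_homology(2)[OF xy]) (simp add: rxy)
  moreover have "int (k + 1) = int k + 1" by simp
  ultimately show False using nontrivial_if_iso_integer by metis
qed

end

theorem theorem2:
  fixes P :: "'a set" and leq :: "'a rel" and r :: "'a \<Rightarrow> nat"
    and m n :: nat and X :: "'b topology"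
  assumes "finite_graded_poset P leq m"
    and "is_rank_function P leq r"
    and "homology_manifold n X"
    and "triangulates (order_complex leq) X"
  shows "(\<forall>k\<le>n. \<forall>i::int. i \<le> int k - 1 \<longrightarrow>
            complex_homology i (rank_truncated_complex leq r k) \<cong> homology_group i X) \<and>
         (\<forall>k<n. free_abelian (complex_homology (int k) (rank_truncated_complex leq r k)) \<and>
            \<not> trivial_group (complex_homology (int k) (rank_truncated_complex leq r k)))"
proof -
  interpret manifold_poset P leq m r n X
    using assms by unfold_locales
  show ?thesis
    unfolding complex_homology_def
    using truncation_homology_iso truncation_homology_free truncation_homology_nontrivial by blast
qed

end
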